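(* For each $\epsilon>0$ there exist $j\in\mathbb{N}$ and $\delta>0$ such that the following holds. Let $p,q\in(\epsilon,1-\epsilon)$ with $p-q>\epsilon$, and let $f:\{0,1\}^n\to\{0,1\}$ be $(q,p,\delta)$-almost monotone. Then there exists a monotone $j$-junta $g:\{0,1\}^n\to\{0,1\}$ such that \[\Pr_{\mathbf{x}\sim\mu_q}[f(\mathbf{x})>g(\mathbf{x})]<\epsilon\quad\text{and}\quad\Pr_{\mathbf{x}\sim\mu_p}[f(\mathbf{x})<g(\mathbf{x})]<\epsilon.\]
   Context: $\mu_p$ is the $p$-biased product measure on $\{0,1\}^n$ (coordinates independent, each equal to $1$ with probability $p$). For $q<p$, $D(q,p)$ is the distribution of $(\mathbf{x},\mathbf{y})\in\{0,1\}^n\times\{0,1\}^n$ in which the pairs $(\mathbf{x}_i,\mathbf{y}_i)$ are independent, $\mathbf{x}_i\le\mathbf{y}_i$ always, $\Pr[\mathbf{x}_i=1]=q$ and $\Pr[\mathbf{y}_i=1]=p$. $f$ is $(q,p,\delta)$-almost monotone if $\Pr_{(\mathbf{x},\mathbf{y})\sim D(q,p)}[f(\mathbf{x})>f(\mathbf{y})]<\delta$. $g$ is monotone if $g(x)\le g(y)$ whenever $x_i\le y_i$ for all $i$; $g$ is a $j$-junta if it depends on at most $j$ coordinates. *)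

theory Defs
  imports "HOL-Probability.Probability" "HOL-Probability.Product_PMF"
begin

text \<open>
  The dimension \<open>n\<close> is quantified inside the theorem, so \<open>{0,1}\<^sup>n\<close> is a set of functions
  \<open>nat \<Rightarrow> bool\<close> (with 1 as \<open>True\<close>) padded by \<open>False\<close> at indices \<open>i \<ge> n\<close>. On this set the
  function order \<open>x \<le> y\<close> is the coordinatewise order. Boolean functions are total on
  \<open>nat \<Rightarrow> bool\<close>, but only their values on the cube matter below; \<open>f x > g x\<close> on \<open>bool\<close> says
  that \<open>f x = 1\<close> and \<open>g x = 0\<close>.
\<close>

definition cube :: "nat \<Rightarrow> (nat \<Rightarrow> bool) set" where
  "cube n = {x. \<forall>i\<ge>n. \<not> x i}"

definition mu :: "nat \<Rightarrow> real \<Rightarrow> (nat \<Rightarrow> bool) pmf" where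
  "mu n p = Pi_pmf {..<n} False (\<lambda>_. bernoulli_pmf p)"

text \<open>
  The law of one pair \<open>(x\<^sub>i, y\<^sub>i)\<close>. For \<open>0 \<le> q \<le> p \<le> 1\<close> it is the only law with
  \<open>x\<^sub>i \<le> y\<^sub>i\<close>, \<open>Pr[x\<^sub>i = 1] = q\<close> and \<open>Pr[y\<^sub>i = 1] = p\<close>; see \<open>coupling_iff\<close> below.
\<close>

definition coupling :: "real \<Rightarrow> real \<Rightarrow> (bool \<times> bool) pmf" where
  "coupling q p =
     pmf_of_list [((True, True), q), ((False, True), p - q), ((False, False), 1 - p)]"

definition D :: "nat \<Rightarrow> real \<Rightarrow> real \<Rightarrow> ((nat \<Rightarrow> bool) \<times> (nat \<Rightarrow> bool)) pmf" where
  "D n q p = map_pmf (\<lambda>z. (\<lambda>i. fst (z i), \<lambda>i. snd (z i)))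
                     (Pi_pmf {..<n} (False, False) (\<lambda>_. coupling q p))"

definition almost_monotone ::
    "nat \<Rightarrow> real \<Rightarrow> real \<Rightarrow> real \<Rightarrow> ((nat \<Rightarrow> bool) \<Rightarrow> bool) \<Rightarrow> bool" where
  "almost_monotone n q p \<delta> f \<longleftrightarrow> measure_pmf.prob (D n q p) {(x, y). f x > f y} < \<delta>"

definition junta :: "nat \<Rightarrow> nat \<Rightarrow> ((nat \<Rightarrow> bool) \<Rightarrow> bool) \<Rightarrow> bool" where
  "junta n j g \<longleftrightarrow>
     (\<exists>J \<subseteq> {..<n}. card J \<le> j \<and>
        (\<forall>x \<in> cube n. \<forall>y \<in> cube n. (\<forall>i\<in>J. x i = y i) \<longrightarrow> g x = g y))"

lemma le_cube_iff:
  assumes "x \<in> cube n" "y \<in> cube n"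
  shows "x \<le> y \<longleftrightarrow> (\<forall>i<n. x i \<le> y i)"
proof -
  have "\<not> x i" if "\<not> i < n" for i using assms(1) that by (simp add: cube_def)
  thus ?thesis unfolding le_fun_def le_bool_def by blast
qed

lemma set_pmf_mu: "set_pmf (mu n p) \<subseteq> cube n"
  unfolding mu_def using set_Pi_pmf_subset[of "{..<n}" False "\<lambda>_. bernoulli_pmf p"]
  by (auto simp: cube_def)

lemma pmf_coupling:
  assumes "0 \<le> q" "q \<le> p" "p \<le> 1"
  shows "pmf (coupling q p) (True, True) = q" "pmf (coupling q p) (False, True) = p - q"
    "pmf (coupling q p) (False, False) = 1 - p" "pmf (coupling q p) (True, False) = 0"
proof -
  have wf: "pmf_of_list_wf [((True, True), q), ((False, True), p - q), ((False, False), 1 - p)]"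
    using assms by (intro pmf_of_list_wfI) auto
  show "pmf (coupling q p) (True, True) = q" "pmf (coupling q p) (False, True) = p - q"
    "pmf (coupling q p) (False, False) = 1 - p" "pmf (coupling q p) (True, False) = 0"
    unfolding coupling_def by (simp_all add: pmf_pmf_of_list[OF wf])
qed

lemma pmf_map_bool_pair:
  fixes P :: "(bool \<times> bool) pmf"
  shows "pmf (map_pmf fst P) True = pmf P (True, True) + pmf P (True, False)"
    and "pmf (map_pmf snd P) True = pmf P (True, True) + pmf P (False, True)"
proof -
  have 1: "fst -` {True} = {(True, True), (True, False)}" (is "_ = ?A")
  proof (rule set_eqI)
    fix z :: "bool \<times> bool"
    obtain a b where "z = (a, b)" by (cases z)
    thus "z \<in> fst -` {True} \<longleftrightarrow> z \<in> ?A" by (cases a; cases b) simp_all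
  qed
  have 2: "snd -` {True} = {(True, True), (False, True)}" (is "_ = ?B")
  proof (rule set_eqI)
    fix z :: "bool \<times> bool"
    obtain a b where "z = (a, b)" by (cases z)
    thus "z \<in> snd -` {True} \<longleftrightarrow> z \<in> ?B" by (cases a; cases b) simp_all
  qed
  show "pmf (map_pmf fst P) True = pmf P (True, True) + pmf P (True, False)"
    unfolding pmf_map 1 by (subst measure_measure_pmf_finite) simp_all
  show "pmf (map_pmf snd P) True = pmf P (True, True) + pmf P (False, True)"
    unfolding pmf_map 2 by (subst measure_measure_pmf_finite) simp_all
qed

lemma coupling_iff:
  assumes "0 \<le> q" "q \<le> p" "p \<le> 1"
  shows "P = coupling q p \<longleftrightarrow>
    (\<forall>(a, b) \<in> set_pmf P. a \<le> b) \<and> map_pmf fst P = bernoulli_pmf q \<and> map_pmf snd P = bernoulli_pmf p"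
    (is "_ \<longleftrightarrow> ?R P")
proof -
  have bool_eq: "A = B \<longleftrightarrow> pmf A True = pmf B True" for A B :: "bool pmf"
  proof
    assume h: "pmf A True = pmf B True"
    have "pmf C True + pmf C False = 1" for C :: "bool pmf"
    proof -
      have "(\<Sum>b\<in>UNIV. pmf C b) = 1" by (rule sum_pmf_eq_1) simp_all
      thus ?thesis by (simp add: UNIV_bool)
    qed
    from this[of A] this[of B] h have "pmf A False = pmf B False" by linarith
    with h have "pmf A b = pmf B b" for b by (cases b) simp_all
    thus "A = B" by (rule pmf_eqI)
  qed simp
  have R: "?R P \<longleftrightarrow> pmf P (True, False) = 0 \<and> pmf P (True, True) = q \<and>
      pmf P (True, True) + pmf P (False, True) = p" for P
  proof -
    have "(\<forall>(a, b) \<in> set_pmf P. a \<le> b) \<longleftrightarrow> (True, False) \<notin> set_pmf P"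
    proof
      assume *: "(True, False) \<notin> set_pmf P"
      have "a \<le> b" if "(a, b) \<in> set_pmf P" for a b
        using * that by (cases a; cases b) simp_all
      thus "\<forall>(a, b) \<in> set_pmf P. a \<le> b" by blast
    qed fastforce
    also have "\<dots> \<longleftrightarrow> pmf P (True, False) = 0" by (simp add: set_pmf_iff)
    finally show ?thesis using assms by (auto simp: bool_eq pmf_map_bool_pair)
  qed
  have total: "pmf P (True, True) + pmf P (True, False) + pmf P (False, True) + pmf P (False, False) = 1"
    for P :: "(bool \<times> bool) pmf"
  proof -
    have *: "(UNIV :: (bool \<times> bool) set) =
        {(True, True), (True, False), (False, True), (False, False)}"
      (is "_ = ?A")
    proof (rule set_eqI)
      fix z :: "bool \<times> bool"
      obtain a b where "z = (a, b)" by (cases z)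
      thus "z \<in> UNIV \<longleftrightarrow> z \<in> ?A" by (cases a; cases b) simp_all
    qed
    have "(\<Sum>x\<in>UNIV. pmf P x) = 1" by (rule sum_pmf_eq_1) simp_all
    thus ?thesis unfolding * by simp
  qed
  show ?thesis
  proof
    assume "P = coupling q p"
    thus "?R P" unfolding R using pmf_coupling[OF assms] by simp
  next
    assume "?R P"
    hence "pmf P (True, False) = 0" "pmf P (True, True) = q" "pmf P (False, True) = p - q"
      unfolding R by auto
    moreover from this total[of P] have "pmf P (False, False) = 1 - p" by simp
    ultimately have "pmf P (a, b) = pmf (coupling q p) (a, b)" for a b
      using pmf_coupling[OF assms] by (cases a; cases b) simp_all
    thus "P = coupling q p" by (intro pmf_eqI) auto
  qed
qed

lemma marginals_D:
  assumes "0 \<le> q" "q \<le> p" "p \<le> 1"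
  shows "map_pmf fst (D n q p) = mu n q" "map_pmf snd (D n q p) = mu n p"
proof -
  have *: "map_pmf fst (coupling q p) = bernoulli_pmf q" "map_pmf snd (coupling q p) = bernoulli_pmf p"
    using coupling_iff[OF assms] by auto
  show "map_pmf fst (D n q p) = mu n q" "map_pmf snd (D n q p) = mu n p"
    unfolding D_def mu_def *[symmetric]
    by (simp_all add: Pi_pmf_map[where dflt = "(False, False)"] map_pmf_comp comp_def)
qed

end

theory Submission
  imports Defs
begin

text \<open>
  Let \<open>z\<^sub>t\<close>, \<open>q \<le> t \<le> p\<close>, be the monotone coupling of the measures \<open>\<mu>\<^sub>t\<close>. Thresholding
  \<open>E[f(z\<^sub>q) | z\<^sub>t]\<close> at rapidly decreasing heights \<open>\<eta>\<^sub>t\<close> gives Boolean functions \<open>h\<^sub>t\<close> with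
  \<open>f(z\<^sub>q) \<le> h\<^sub>s(z\<^sub>s) \<le> h\<^sub>t(z\<^sub>t) \<le> f(z\<^sub>p)\<close> up to small probability. Among \<open>M\<close> consecutive
  levels the mean grows by at most \<open>1/M\<close> somewhere, and there \<open>h\<^sub>s\<close> is stable under noise of
  rate \<open>\<alpha> \<approx> 1/M\<close> up to \<open>O(\<alpha>)\<close>. A version of Friedgut's theorem at scale \<open>\<alpha>\<close> then says that
  \<open>h\<^sub>s\<close> is close to a junta whose size does not depend on \<open>\<alpha>\<close>: influences are measured for random
  sets \<open>B\<close> of density \<open>\<alpha>\<close> instead of single coordinates, and the junta consists of the coordinates
  \<open>i\<close> for which \<open>B\<close> is often influential given \<open>i \<in> B\<close>. Hence, unless \<open>E\<^sub>p f\<close> is close to 1,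
  setting boundedly many coordinates to 0 makes \<open>E\<^sub>q f\<close> small. Applied to restrictions of \<open>f\<close>, this
  drives an energy increment that ends with a set \<open>J\<close> for which, for most \<open>a \<in> {0,1}\<^sup>J\<close>, either
  \<open>E\<^sub>q[f | a]\<close> is small or \<open>E\<^sub>p[f | c]\<close> is close to 1 for all \<open>c \<ge> a\<close>.
\<close>

section \<open>Product Markov operators\<close>

definition bern :: "real \<Rightarrow> bool \<Rightarrow> real" where
  "bern r b = (if b then r else 1 - r)"

text \<open>
  Coordinates \<open>i \<ge> n\<close> of the point are left unchanged, so that operator identities hold for all
  functions and not only on the cube.
\<close>

primrec kop :: "nat \<Rightarrow> (nat \<Rightarrow> bool \<Rightarrow> bool \<Rightarrow> real) \<Rightarrow> ((nat \<Rightarrow> bool) \<Rightarrow> real) \<Rightarrow> (nat \<Rightarrow> bool) \<Rightarrow> real" where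
  "kop 0 k f x = f x"
| "kop (Suc n) k f x =
     k n (x n) True * kop n k (\<lambda>y. f (y(n := True))) x +
     k n (x n) False * kop n k (\<lambda>y. f (y(n := False))) x"

definition stoch :: "nat \<Rightarrow> (nat \<Rightarrow> bool \<Rightarrow> bool \<Rightarrow> real) \<Rightarrow> bool" where
  "stoch n k \<longleftrightarrow> (\<forall>i<n. \<forall>a. (\<forall>b. k i a b \<ge> 0) \<and> k i a True + k i a False = 1)"

lemma stochI:
  assumes "\<And>i a b. i < n \<Longrightarrow> k i a b \<ge> 0" "\<And>i a. i < n \<Longrightarrow> k i a True + k i a False = 1"
  shows "stoch n k"
  using assms unfolding stoch_def by blast

lemma stoch_SucD:
  assumes "stoch (Suc n) k"
  shows "stoch n k" "k n a b \<ge> 0" "k n a True + k n a False = 1"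
  using assms unfolding stoch_def by auto

lemma kop_upd:
  "m \<ge> n \<Longrightarrow> kop n k f (x(m := c)) = kop n k (\<lambda>y. f (y(m := c))) x"
  by (induction n arbitrary: f) (auto simp: fun_upd_twist)

lemma kop_add: "kop n k (\<lambda>x. f x + g x) x = kop n k f x + kop n k g x"
  by (induction n arbitrary: f g) (simp_all add: algebra_simps)

lemma kop_cmult: "kop n k (\<lambda>x. c * f x) x = c * kop n k f x"
  by (induction n arbitrary: f) (simp_all add: algebra_simps)

lemma kop_multc: "kop n k (\<lambda>x. f x * c) x = kop n k f x * c"
  by (induction n arbitrary: f) (simp_all add: algebra_simps)

lemma kop_diff: "kop n k (\<lambda>x. f x - g x) x = kop n k f x - kop n k g x"
  by (induction n arbitrary: f g) (simp_all add: right_diff_distrib)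

lemma kop_sum: "kop n k (\<lambda>x. \<Sum>i\<in>I. f i x) x = (\<Sum>i\<in>I. kop n k (f i) x)"
proof (induction I rule: infinite_finite_induct)
  case (insert i I)
  then show ?case by (simp add: kop_add)
qed (use kop_cmult[of n k 0 "\<lambda>_. 0" x] in simp_all)

lemma kop_const: "stoch n k \<Longrightarrow> kop n k (\<lambda>_. c) x = c"
proof (induction n)
  case (Suc n)
  then show ?case using stoch_SucD[OF Suc.prems] by (simp add: distrib_right[symmetric])
qed simp

lemma kop_mono_on:
  "stoch n k \<Longrightarrow> (\<And>y. (\<And>i. i \<ge> n \<Longrightarrow> y i = x i) \<Longrightarrow> f y \<le> g y) \<Longrightarrow> kop n k f x \<le> kop n k g x"
proof (induction n arbitrary: f g)
  case 0
  then show ?case by simp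
next
  case (Suc n)
  have "kop n k (\<lambda>y. f (y(n := b))) x \<le> kop n k (\<lambda>y. g (y(n := b))) x" for b
  proof (rule Suc.IH)
    fix y assume "\<And>i. i \<ge> n \<Longrightarrow> y i = x i"
    then show "f (y(n := b)) \<le> g (y(n := b))" by (intro Suc.prems(2)) auto
  qed (rule stoch_SucD[OF Suc.prems(1)])
  then show ?case using stoch_SucD[OF Suc.prems(1)]
    by (auto intro!: add_mono mult_left_mono)
qed

lemma kop_mono: "stoch n k \<Longrightarrow> (\<And>x. f x \<le> g x) \<Longrightarrow> kop n k f x \<le> kop n k g x"
  by (rule kop_mono_on)

lemma kop_nonneg: "stoch n k \<Longrightarrow> (\<And>x. f x \<ge> 0) \<Longrightarrow> kop n k f x \<ge> 0"
  using kop_mono[of n k "\<lambda>_. 0" f x] kop_const[of n k 0 x] by simp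

lemma kop_le_const: "stoch n k \<Longrightarrow> (\<And>x. f x \<le> c) \<Longrightarrow> kop n k f x \<le> c"
  using kop_mono[of n k f "\<lambda>_. c" x] kop_const[of n k c x] by simp

lemma kop_cong_kernel:
  "(\<And>i a b. i < n \<Longrightarrow> k i a b = k' i a b) \<Longrightarrow> kop n k f x = kop n k' f x"
  by (induction n arbitrary: f) auto

text \<open>The average sees the starting point only through the kernel rows it selects and the
  untouched coordinates. This yields both independence of the start for \<open>bern\<close> kernels
  and the fact that conditional expectations given \<open>J\<close> depend only on
  \<open>J\<close>.\<close>

lemma kop_cong_point:
  "(\<And>i b. i < n \<Longrightarrow> k i (x i) b = k' i (x' i) b) \<Longrightarrow> (\<And>i. i \<ge> n \<Longrightarrow> x i = x' i) \<Longrightarrow>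
   kop n k f x = kop n k' f x'"
proof (induction n arbitrary: f x x')
  case 0
  then have "x = x'" by auto
  then show ?case by simp
next
  case (Suc n)
  have "kop n k (\<lambda>y. f (y(n := b))) x = kop n k' (\<lambda>y. f (y(n := b))) x'" for b
  proof -
    have "kop n k (\<lambda>y. f (y(n := b))) x = kop n k f (x(n := b))" by (simp add: kop_upd)
    also have "\<dots> = kop n k' f (x'(n := b))"
    proof (rule Suc.IH)
      fix i c assume "i < n"
      then show "k i ((x(n := b)) i) c = k' i ((x'(n := b)) i) c" using Suc.prems(1)[of i] by simp
    next
      fix i assume "n \<le> i"
      then show "(x(n := b)) i = (x'(n := b)) i" using Suc.prems(2)[of i] by auto
    qed
    finally show ?thesis by (simp add: kop_upd)
  qed
  then show ?case using Suc.prems(1)[of n] by simp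
qed

text \<open>Product kernels compose coordinatewise, so the composition identities below reduce to
  products of 2 by 2 matrices.\<close>

lemma kop_comp:
  "kop n k (kop n k' f) x =
   kop n (\<lambda>i a c. k i a True * k' i True c + k i a False * k' i False c) f x"
  by (induction n arbitrary: f) (simp_all add: kop_upd kop_add kop_cmult algebra_simps)

lemma kop_id: "kop n (\<lambda>_ a b. of_bool (a = b)) f x = f x"
proof (induction n arbitrary: f)
  case (Suc n)
  then show ?case by (cases "x n") (simp_all add: fun_upd_idem)
qed simp

text \<open>Detailed balance in each coordinate suffices. With equal measures it makes noise and
  resampling self-adjoint; with different measures it pairs the upward and downward halves of the
  monotone coupling.\<close>

lemma kop_adjoint:
  assumes "\<And>i a b. i < n \<Longrightarrow> m i a * k i a b = m' i b * k' i b a"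
  shows "kop n (\<lambda>i _. m i) (\<lambda>x. F x * kop n k G x) x0 =
         kop n (\<lambda>i _. m' i) (\<lambda>x. kop n k' F x * G x) x0"
  using assms
proof (induction n arbitrary: F G)
  case (Suc n)
  have IH: "kop n (\<lambda>i _. m i) (\<lambda>x. F x * kop n k G x) x0 =
         kop n (\<lambda>i _. m' i) (\<lambda>x. kop n k' F x * G x) x0" for F G
    by (rule Suc.IH) (use Suc.prems in auto)
  let ?X = "\<lambda>a b. kop n (\<lambda>i _. m i) (\<lambda>x. F (x(n := a)) * kop n k (\<lambda>y. G (y(n := b))) x) x0"
  have "kop (Suc n) (\<lambda>i _. m i) (\<lambda>x. F x * kop (Suc n) k G x) x0 =
     m n True * k n True True * ?X True True + m n True * k n True False * ?X True False +
     m n False * k n False True * ?X False True + m n False * k n False False * ?X False False"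
    by (simp add: kop_upd kop_add kop_cmult distrib_left mult.left_commute mult.assoc)
  also have "\<dots> = m' n True * k' n True True * ?X True True + m' n False * k' n False True * ?X True False +
     m' n True * k' n True False * ?X False True + m' n False * k' n False False * ?X False False"
    by (simp add: Suc.prems)
  also have "\<dots> = kop (Suc n) (\<lambda>i _. m' i) (\<lambda>x. kop (Suc n) k' F x * G x) x0"
    by (simp add: kop_upd kop_add kop_cmult distrib_left distrib_right IH mult.left_commute mult.assoc)
  finally show ?case .
qed simp

text \<open>When the choice \<open>B\<close> of kernels is independent over the coordinates,
  averaging over \<open>B\<close> averages the matrices coordinate by coordinate.\<close>

lemma kop_mixture:
  "kop n (\<lambda>i _. m i) (\<lambda>B. kop n (\<lambda>i. kk i (B i)) f x) B0 =
   kop n (\<lambda>i a b. m i True * kk i True a b + m i False * kk i False a b) f x"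
proof (induction n arbitrary: f)
  case (Suc n)
  have *: "kop n (\<lambda>i. kk i ((B(n := c)) i)) g x = kop n (\<lambda>i. kk i (B i)) g x" for B c g
    by (rule kop_cong_kernel) auto
  show ?case
    by (simp add: * fun_upd_same kop_add kop_cmult Suc.IH del: fun_upd_apply) (simp add: algebra_simps)
qed simp

lemma kop_square_le:
  assumes "stoch n k"
  shows "(kop n k f x)\<^sup>2 \<le> kop n k (\<lambda>x. (f x)\<^sup>2) x"
proof -
  define c where "c = kop n k f x"
  have "0 \<le> kop n k (\<lambda>x. (f x - c)\<^sup>2) x" by (rule kop_nonneg[OF assms]) simp
  also have "(\<lambda>x. (f x - c)\<^sup>2) = (\<lambda>x. ((f x)\<^sup>2 - 2 * c * f x) + c\<^sup>2)"
    by (auto simp: power2_eq_square algebra_simps)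
  also have "kop n k \<dots> x = kop n k (\<lambda>x. (f x)\<^sup>2) x - 2 * c * c + c\<^sup>2"
    unfolding kop_add kop_diff kop_cmult kop_const[OF assms] c_def ..
  finally show ?thesis by (simp add: c_def power2_eq_square)
qed

lemma kop_cauchy_schwarz:
  assumes "stoch n k"
  shows "(kop n k (\<lambda>x. f x * g x) x)\<^sup>2 \<le> kop n k (\<lambda>x. (f x)\<^sup>2) x * kop n k (\<lambda>x. (g x)\<^sup>2) x"
proof -
  define a b c where "a = kop n k (\<lambda>x. (f x)\<^sup>2) x" and "b = kop n k (\<lambda>x. (g x)\<^sup>2) x"
    and "c = kop n k (\<lambda>x. f x * g x) x"
  have q: "0 \<le> s\<^sup>2 * a - 2 * s * t * c + t\<^sup>2 * b" for s t :: real
  proof -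
    have "0 \<le> kop n k (\<lambda>x. (s * f x - t * g x)\<^sup>2) x" by (rule kop_nonneg[OF assms]) simp
    also have "(\<lambda>x. (s * f x - t * g x)\<^sup>2) =
      (\<lambda>x. (s\<^sup>2 * (f x)\<^sup>2 - 2 * s * t * (f x * g x)) + t\<^sup>2 * (g x)\<^sup>2)"
      by (auto simp: power2_eq_square algebra_simps)
    also have "kop n k \<dots> x = s\<^sup>2 * a - 2 * s * t * c + t\<^sup>2 * b"
      unfolding kop_add kop_diff kop_cmult a_def b_def c_def ..
    finally show ?thesis .
  qed
  have nn: "a \<ge> 0" "b \<ge> 0" unfolding a_def b_def by (auto intro!: kop_nonneg[OF assms])
  have "c\<^sup>2 \<le> a * b"
  proof (cases "b = 0")
    case True
    show ?thesis
    proof (rule ccontr)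
      assume *: "\<not> c\<^sup>2 \<le> a * b"
      then have "c \<noteq> 0" using True by auto
      \<comment> \<open>For \<open>b = 0\<close> these values make the quadratic form equal to
        -1.\<close>
      then show False using q[of 1 "(a + 1) / (2 * c)"] True by (simp add: field_simps)
    qed
  next
    case False
    have "0 \<le> b * (a * b - c\<^sup>2)" using q[of b c] by (simp add: power2_eq_square algebra_simps)
    then show ?thesis using nn False by (simp add: zero_le_mult_iff)
  qed
  then show ?thesis by (simp add: a_def b_def c_def)
qed

section \<open>Biased means, resampling and noise\<close>

definition mean :: "nat \<Rightarrow> real \<Rightarrow> ((nat \<Rightarrow> bool) \<Rightarrow> real) \<Rightarrow> real" where
  "mean n r f = kop n (\<lambda>_ _. bern r) f (\<lambda>_. False)"

text \<open>Conditional expectation given the coordinates outside \<open>B\<close>, hence an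
  orthogonal projection for the \<open>r\<close>-biased measure.\<close>

definition resamp :: "nat \<Rightarrow> real \<Rightarrow> (nat \<Rightarrow> bool) \<Rightarrow> ((nat \<Rightarrow> bool) \<Rightarrow> real) \<Rightarrow> (nat \<Rightarrow> bool) \<Rightarrow> real" where
  "resamp n r B = kop n (\<lambda>i a b. if B i then bern r b else of_bool (a = b))"

text \<open>The biased Bonami-Beckner operator with retention probability \<open>\<rho>\<close>; by
  \<open>noise_noise\<close> it is a heat semigroup with time \<open>- ln \<rho>\<close>.\<close>

definition noise :: "nat \<Rightarrow> real \<Rightarrow> real \<Rightarrow> ((nat \<Rightarrow> bool) \<Rightarrow> real) \<Rightarrow> (nat \<Rightarrow> bool) \<Rightarrow> real" where
  "noise n r \<rho> = kop n (\<lambda>_ a b. \<rho> * of_bool (a = b) + (1 - \<rho>) * bern r b)"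

lemma bern_simps [simp]: "bern r True = r" "bern r False = 1 - r"
  by (auto simp: bern_def)

lemma stoch_bern: "0 \<le> r \<Longrightarrow> r \<le> 1 \<Longrightarrow> stoch n (\<lambda>_ _. bern r)"
  by (auto intro!: stochI simp: bern_def)

lemma stoch_resamp: "0 \<le> r \<Longrightarrow> r \<le> 1 \<Longrightarrow> stoch n (\<lambda>i a b. if B i then bern r b else of_bool (a = b))"
  by (auto intro!: stochI simp: bern_def)

lemma stoch_noise: "0 \<le> r \<Longrightarrow> r \<le> 1 \<Longrightarrow> 0 \<le> \<rho> \<Longrightarrow> \<rho> \<le> 1 \<Longrightarrow>
    stoch n (\<lambda>_ a b. \<rho> * of_bool (a = b) + (1 - \<rho>) * bern r b)"
  by (rule stochI) (auto simp: bern_def intro!: add_nonneg_nonneg mult_nonneg_nonneg, simp_all add: algebra_simps)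

section \<open>Noise, resampling and hypercontractivity\<close>

lemma mean_simps:
  "mean n r (\<lambda>x. f x + g x) = mean n r f + mean n r g"
  "mean n r (\<lambda>x. f x - g x) = mean n r f - mean n r g"
  "mean n r (\<lambda>x. c * f x) = c * mean n r f"
  "mean n r (\<lambda>x. f x * c) = mean n r f * c"
  unfolding mean_def by (rule kop_add kop_diff kop_cmult kop_multc)+

lemma mean_sum: "mean n r (\<lambda>x. \<Sum>i\<in>I. f i x) = (\<Sum>i\<in>I. mean n r (f i))"
  unfolding mean_def by (rule kop_sum)

lemma mean_Suc: "mean (Suc n) r f =
    r * mean n r (\<lambda>y. f (y(n := True))) + (1 - r) * mean n r (\<lambda>y. f (y(n := False)))"
  by (simp add: mean_def)

context
  fixes r :: real
  assumes r01: "0 \<le> r" "r \<le> 1"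
begin

lemma mean_const: "mean n r (\<lambda>_. c) = c"
  unfolding mean_def by (rule kop_const[OF stoch_bern[OF r01]])

lemma mean_mono: "(\<And>x. f x \<le> g x) \<Longrightarrow> mean n r f \<le> mean n r g"
  unfolding mean_def by (rule kop_mono[OF stoch_bern[OF r01]])

lemma mean_nonneg: "(\<And>x. 0 \<le> f x) \<Longrightarrow> 0 \<le> mean n r f"
  unfolding mean_def by (rule kop_nonneg[OF stoch_bern[OF r01]])

lemma mean_le_const: "(\<And>x. f x \<le> c) \<Longrightarrow> mean n r f \<le> c"
  unfolding mean_def by (rule kop_le_const[OF stoch_bern[OF r01]])

lemma mean_square_le: "(mean n r f)\<^sup>2 \<le> mean n r (\<lambda>x. (f x)\<^sup>2)"
  unfolding mean_def by (rule kop_square_le[OF stoch_bern[OF r01]])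

lemma mean_cauchy_schwarz:
  "(mean n r (\<lambda>x. f x * g x))\<^sup>2 \<le> mean n r (\<lambda>x. (f x)\<^sup>2) * mean n r (\<lambda>x. (g x)\<^sup>2)"
  unfolding mean_def by (rule kop_cauchy_schwarz[OF stoch_bern[OF r01]])

end

lemma mean_noise: "mean n r (noise n r \<rho> f) = mean n r f"
proof -
  have "mean n r (noise n r \<rho> f) = kop n (\<lambda>_ _. bern r) f (\<lambda>_. False)"
    unfolding mean_def noise_def kop_comp
    by (rule kop_cong_kernel) (auto simp: bern_def algebra_simps)
  then show ?thesis by (simp add: mean_def)
qed

lemma mean_resamp: "mean n r (resamp n r B f) = mean n r f"
proof -
  have "mean n r (resamp n r B f) = kop n (\<lambda>_ _. bern r) f (\<lambda>_. False)"
    unfolding mean_def resamp_def kop_comp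
    by (rule kop_cong_kernel) (auto simp: bern_def algebra_simps)
  then show ?thesis by (simp add: mean_def)
qed

lemma mean_noise_adjoint: "mean n r (\<lambda>x. f x * noise n r \<rho> g x) = mean n r (\<lambda>x. noise n r \<rho> f x * g x)"
  unfolding mean_def noise_def by (rule kop_adjoint) (auto simp: bern_def)

lemma mean_resamp_adjoint: "mean n r (\<lambda>x. f x * resamp n r B g x) = mean n r (\<lambda>x. resamp n r B f x * g x)"
  unfolding mean_def resamp_def by (rule kop_adjoint) (auto simp: bern_def)

lemma noise_noise: "noise n r \<rho> (noise n r \<sigma> f) = noise n r (\<rho> * \<sigma>) f"
  unfolding noise_def kop_comp
  by (intro ext kop_cong_kernel) (auto simp: bern_def algebra_simps)

lemma noise_1: "noise n r 1 f = f"
  using kop_id[of n f] by (auto simp: noise_def)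

lemma resamp_resamp: "resamp n r B (resamp n r B' f) = resamp n r (\<lambda>i. B i \<or> B' i) f"
  unfolding resamp_def kop_comp
  by (intro ext kop_cong_kernel) (auto simp: bern_def algebra_simps)

lemma resamp_noise: "resamp n r B (noise n r \<rho> f) = noise n r \<rho> (resamp n r B f)"
  unfolding resamp_def noise_def kop_comp
  by (intro ext kop_cong_kernel) (auto simp: bern_def algebra_simps)

lemma resamp_cong: "(\<And>i. i < n \<Longrightarrow> B i = B' i) \<Longrightarrow> resamp n r B f = resamp n r B' f"
  unfolding resamp_def by (intro ext kop_cong_kernel) auto

lemma resamp_none: "(\<And>i. i < n \<Longrightarrow> \<not> B i) \<Longrightarrow> resamp n r B f = f"
  using resamp_cong[of n B "\<lambda>_. False" r f] kop_id[of n f] by (auto simp: resamp_def)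

text \<open>Noise is resampling of a random set of density \<open>\<alpha>\<close>, so noise
  sensitivity becomes an average influence of random sets.\<close>

lemma mean_resamp_mixture: "mean n \<alpha> (\<lambda>B. resamp n r B f x) = noise n r (1 - \<alpha>) f x"
proof -
  have "mean n \<alpha> (\<lambda>B. resamp n r B f x) =
    kop n (\<lambda>i a b. bern \<alpha> True * bern r b + bern \<alpha> False * of_bool (a = b)) f x"
    using kop_mixture[of n "\<lambda>_. bern \<alpha>" "\<lambda>_ c a b. if c then bern r b else of_bool (a = b)" f x]
    by (simp add: mean_def resamp_def)
  also have "\<dots> = noise n r (1 - \<alpha>) f x"
    unfolding noise_def by (rule kop_cong_kernel) (auto simp: bern_def)
  finally show ?thesis .
qed

lemma resamp_diff: "resamp n r B (\<lambda>x. f x - g x) x = resamp n r B f x - resamp n r B g x"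
  unfolding resamp_def by (rule kop_diff)

lemma noise_diff: "noise n r \<rho> (\<lambda>x. f x - g x) x = noise n r \<rho> f x - noise n r \<rho> g x"
  unfolding noise_def by (rule kop_diff)

lemma mean_resamp_square:
  "mean n r (\<lambda>x. (resamp n r B f x)\<^sup>2) = mean n r (\<lambda>x. f x * resamp n r B f x)"
proof -
  have "mean n r (\<lambda>x. f x * resamp n r B f x) = mean n r (\<lambda>x. f x * resamp n r B (resamp n r B f) x)"
    by (simp add: resamp_resamp)
  also have "\<dots> = mean n r (\<lambda>x. (resamp n r B f x)\<^sup>2)"
    by (subst mean_resamp_adjoint) (simp add: power2_eq_square)
  finally show ?thesis ..
qed

text \<open>Pythagoras for the projection \<open>resamp n r B\<close>.\<close>

lemma mean_resamp_diff_square: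
  "mean n r (\<lambda>x. (f x - resamp n r B f x)\<^sup>2) = mean n r (\<lambda>x. (f x)\<^sup>2) - mean n r (\<lambda>x. (resamp n r B f x)\<^sup>2)"
proof -
  have "(\<lambda>x. (f x - resamp n r B f x)\<^sup>2) =
     (\<lambda>x. ((f x)\<^sup>2 + (resamp n r B f x)\<^sup>2) - 2 * (f x * resamp n r B f x))"
    by (auto simp: power2_eq_square algebra_simps)
  then have "mean n r (\<lambda>x. (f x - resamp n r B f x)\<^sup>2) =
     mean n r (\<lambda>x. (f x)\<^sup>2) + mean n r (\<lambda>x. (resamp n r B f x)\<^sup>2) - 2 * mean n r (\<lambda>x. f x * resamp n r B f x)"
    by (simp only: mean_simps)
  then show ?thesis by (simp add: mean_resamp_square)
qed

lemma mean_resamp_contract: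
  assumes "0 \<le> r" "r \<le> 1"
  shows "mean n r (\<lambda>x. (resamp n r B f x)\<^sup>2) \<le> mean n r (\<lambda>x. (f x)\<^sup>2)"
proof -
  have "mean n r (\<lambda>x. (resamp n r B f x)\<^sup>2) \<le> mean n r (resamp n r B (\<lambda>x. (f x)\<^sup>2))"
    using assms by (intro mean_mono) (auto simp: resamp_def intro!: kop_square_le stoch_resamp)
  then show ?thesis by (simp add: mean_resamp)
qed

lemma mean_noise_contract:
  assumes "0 \<le> r" "r \<le> 1" "0 \<le> \<rho>" "\<rho> \<le> 1"
  shows "mean n r (\<lambda>x. (noise n r \<rho> f x)\<^sup>2) \<le> mean n r (\<lambda>x. (f x)\<^sup>2)"
proof -
  have "mean n r (\<lambda>x. (noise n r \<rho> f x)\<^sup>2) \<le> mean n r (noise n r \<rho> (\<lambda>x. (f x)\<^sup>2))"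
    using assms by (intro mean_mono) (auto simp: noise_def intro!: kop_square_le stoch_noise)
  then show ?thesis by (simp add: mean_noise)
qed

text \<open>Induction on the dimension: expand the fourth moment in the last coordinate and compare
  with the square of the second moment. For biased coordinates the cubic term survives; it is
  absorbed by the arithmetic-geometric mean inequality, at the price of \<open>\<rho>\<close> being
  small relative to \<open>\<kappa>\<close>.\<close>

lemma hypercontractive_2_4:
  assumes lam: "0 < \<kappa>" "\<kappa> \<le> 1/2" and r: "\<kappa> \<le> r" "r \<le> 1 - \<kappa>" and rho: "0 \<le> \<rho>" "\<rho> \<le> \<kappa> / 2"
  shows "mean n r (\<lambda>x. (noise n r \<rho> f x) ^ 4) \<le> (mean n r (\<lambda>x. (f x)\<^sup>2))\<^sup>2"
proof (induction n arbitrary: f)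
  case 0
  then show ?case by (simp add: mean_def noise_def power_mult[symmetric])
next
  case (Suc n)
  have r01: "0 \<le> r" "r \<le> 1" using lam r by auto
  define v where "v = r * (1 - r)"
  have v: "\<kappa> / 2 \<le> v" "v \<le> 1"
  proof -
    have "\<kappa> * (1 - \<kappa>) \<le> v" unfolding v_def
    proof -
      have "0 \<le> (r - \<kappa>) * (1 - \<kappa> - r)" using r by simp
      then show "\<kappa> * (1 - \<kappa>) \<le> r * (1 - r)" by (simp add: algebra_simps)
    qed
    moreover have "\<kappa> * (1/2) \<le> \<kappa> * (1 - \<kappa>)" using lam by (intro mult_left_mono) auto
    ultimately show "\<kappa> / 2 \<le> v" by simp
    show "v \<le> 1" unfolding v_def using r01 by (simp add: mult_le_one)
  qed
  define fT fF where "fT = (\<lambda>y. f (y(n := True)))" and "fF = (\<lambda>y. f (y(n := False)))"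
  define a d where "a = (\<lambda>y. r * fT y + (1 - r) * fF y)" and "d = (\<lambda>y. fT y - fF y)"
  define A D where "A = noise n r \<rho> a" and "D = noise n r \<rho> d"
  \<comment> \<open>On the last coordinate \<open>f\<close> is its average \<open>a\<close> plus
    \<open>d\<close> times a centred variable with values \<open>1 - r\<close> and
    \<open>- r\<close>. Noise preserves the first part and scales the second by
    \<open>\<rho>\<close>.\<close>
  have fTa: "fT = (\<lambda>y. a y + (1 - r) * d y)" and fFa: "fF = (\<lambda>y. a y - r * d y)"
    unfolding a_def d_def by (auto simp: algebra_simps)
  have NT: "noise n r \<rho> fT x = A x + (1 - r) * D x" for x
    unfolding fTa A_def D_def noise_def by (simp only: kop_add kop_cmult)
  have NF: "noise n r \<rho> fF x = A x - r * D x" for x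
    unfolding fFa A_def D_def noise_def by (simp only: kop_diff kop_cmult)
  have ST: "noise (Suc n) r \<rho> f (y(n := True)) = A y + \<rho> * (1 - r) * D y" for y
  proof -
    have "noise (Suc n) r \<rho> f (y(n := True)) =
       (\<rho> + (1 - \<rho>) * r) * noise n r \<rho> fT y + ((1 - \<rho>) * (1 - r)) * noise n r \<rho> fF y"
      by (simp add: noise_def kop_upd fT_def fF_def)
    then show ?thesis unfolding NT NF by (simp add: algebra_simps)
  qed
  have SF: "noise (Suc n) r \<rho> f (y(n := False)) = A y - \<rho> * r * D y" for y
  proof -
    have "noise (Suc n) r \<rho> f (y(n := False)) =
       ((1 - \<rho>) * r) * noise n r \<rho> fT y + (\<rho> + (1 - \<rho>) * (1 - r)) * noise n r \<rho> fF y"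
      by (simp add: noise_def kop_upd fT_def fF_def)
    then show ?thesis unfolding NT NF by (simp add: algebra_simps)
  qed
  define \<alpha> \<beta> where "\<alpha> = mean n r (\<lambda>x. (a x)\<^sup>2)" and "\<beta> = mean n r (\<lambda>x. (d x)\<^sup>2)"
  have ab0: "\<alpha> \<ge> 0" "\<beta> \<ge> 0" unfolding \<alpha>_def \<beta>_def by (auto intro!: mean_nonneg r01)
  have A4: "mean n r (\<lambda>x. (A x) ^ 4) \<le> \<alpha>\<^sup>2" and D4: "mean n r (\<lambda>x. (D x) ^ 4) \<le> \<beta>\<^sup>2"
    unfolding A_def D_def \<alpha>_def \<beta>_def by (rule Suc.IH)+
  have A2D2: "mean n r (\<lambda>x. (A x)\<^sup>2 * (D x)\<^sup>2) \<le> \<alpha> * \<beta>"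
  proof -
    have "(mean n r (\<lambda>x. (A x)\<^sup>2 * (D x)\<^sup>2))\<^sup>2 \<le> mean n r (\<lambda>x. ((A x)\<^sup>2)\<^sup>2) * mean n r (\<lambda>x. ((D x)\<^sup>2)\<^sup>2)"
      by (rule mean_cauchy_schwarz[OF r01])
    also have "\<dots> = mean n r (\<lambda>x. (A x) ^ 4) * mean n r (\<lambda>x. (D x) ^ 4)" by simp
    also have "\<dots> \<le> \<alpha>\<^sup>2 * \<beta>\<^sup>2" by (intro mult_mono A4 D4) (auto intro!: mean_nonneg r01)
    also have "\<dots> = (\<alpha> * \<beta>)\<^sup>2" by (simp add: power_mult_distrib)
    finally show ?thesis by (rule power2_le_imp_le) (simp add: ab0)
  qed
  have AD3: "A x * D x ^ 3 \<le> ((A x)\<^sup>2 * (D x)\<^sup>2 + (D x) ^ 4) / 2"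
     "- (A x * D x ^ 3) \<le> ((A x)\<^sup>2 * (D x)\<^sup>2 + (D x) ^ 4) / 2" for x
  proof -
    have "0 \<le> (D x)\<^sup>2 * (A x - D x)\<^sup>2" "0 \<le> (D x)\<^sup>2 * (A x + D x)\<^sup>2" by simp_all
    then show "A x * D x ^ 3 \<le> ((A x)\<^sup>2 * (D x)\<^sup>2 + (D x) ^ 4) / 2"
     "- (A x * D x ^ 3) \<le> ((A x)\<^sup>2 * (D x)\<^sup>2 + (D x) ^ 4) / 2"
      by (simp_all add: power2_eq_square power3_eq_cube power4_eq_xxxx algebra_simps)
  qed
  have pw: "r * (A x + \<rho> * (1 - r) * D x) ^ 4 + (1 - r) * (A x - \<rho> * r * D x) ^ 4 \<le>
     A x ^ 4 + (6 * \<rho>\<^sup>2 * v + 2 * \<rho> ^ 3 * v) * ((A x)\<^sup>2 * (D x)\<^sup>2) + (2 * \<rho> ^ 3 * v + \<rho> ^ 4 * v) * (D x) ^ 4" for x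
  proof -
    \<comment> \<open>The centred variable has second, third and fourth moments \<open>v\<close>,
      \<open>v * (1 - 2 * r)\<close> and \<open>v * (1 - 3 * v)\<close>.\<close>
    have "r * (A x + \<rho> * (1 - r) * D x) ^ 4 + (1 - r) * (A x - \<rho> * r * D x) ^ 4 =
      A x ^ 4 + 6 * \<rho>\<^sup>2 * v * ((A x)\<^sup>2 * (D x)\<^sup>2) + 4 * \<rho> ^ 3 * v * ((1 - 2 * r) * (A x * D x ^ 3)) +
        \<rho> ^ 4 * v * (1 - 3 * v) * (D x) ^ 4"
      unfolding v_def by (simp add: power2_eq_square power3_eq_cube power4_eq_xxxx algebra_simps)
    also have "4 * \<rho> ^ 3 * v * ((1 - 2 * r) * (A x * D x ^ 3)) \<le>
       4 * \<rho> ^ 3 * v * (((A x)\<^sup>2 * (D x)\<^sup>2 + (D x) ^ 4) / 2)"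
    proof (rule mult_left_mono)
      have "(1 - 2 * r) * (A x * D x ^ 3) \<le> \<bar>1 - 2 * r\<bar> * \<bar>A x * D x ^ 3\<bar>"
        by (metis abs_ge_self abs_mult)
      also have "\<dots> \<le> 1 * (((A x)\<^sup>2 * (D x)\<^sup>2 + (D x) ^ 4) / 2)"
        using AD3[of x] r01 by (intro mult_mono) (auto simp: abs_le_iff)
      finally show "(1 - 2 * r) * (A x * D x ^ 3) \<le> ((A x)\<^sup>2 * (D x)\<^sup>2 + (D x) ^ 4) / 2" by simp
      show "0 \<le> 4 * \<rho> ^ 3 * v" using rho v lam by simp
    qed
    also have "\<rho> ^ 4 * v * (1 - 3 * v) * (D x) ^ 4 \<le> \<rho> ^ 4 * v * 1 * (D x) ^ 4"
      using rho v lam by (intro mult_right_mono mult_left_mono) auto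
    also have "A x ^ 4 + 6 * \<rho>\<^sup>2 * v * ((A x)\<^sup>2 * (D x)\<^sup>2) +
         4 * \<rho> ^ 3 * v * (((A x)\<^sup>2 * (D x)\<^sup>2 + (D x) ^ 4) / 2) + \<rho> ^ 4 * v * 1 * (D x) ^ 4 =
       A x ^ 4 + (6 * \<rho>\<^sup>2 * v + 2 * \<rho> ^ 3 * v) * ((A x)\<^sup>2 * (D x)\<^sup>2) + (2 * \<rho> ^ 3 * v + \<rho> ^ 4 * v) * (D x) ^ 4"
      by (simp add: field_simps)
    finally show ?thesis by simp
  qed
  have "mean (Suc n) r (\<lambda>x. (noise (Suc n) r \<rho> f x) ^ 4) =
     mean n r (\<lambda>x. r * (A x + \<rho> * (1 - r) * D x) ^ 4 + (1 - r) * (A x - \<rho> * r * D x) ^ 4)"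
    by (simp only: mean_Suc ST SF mean_simps)
  also have "\<dots> \<le> mean n r (\<lambda>x. A x ^ 4 + (6 * \<rho>\<^sup>2 * v + 2 * \<rho> ^ 3 * v) * ((A x)\<^sup>2 * (D x)\<^sup>2) +
      (2 * \<rho> ^ 3 * v + \<rho> ^ 4 * v) * (D x) ^ 4)"
    by (rule mean_mono[OF r01 pw])
  also have "\<dots> = mean n r (\<lambda>x. A x ^ 4) + (6 * \<rho>\<^sup>2 * v + 2 * \<rho> ^ 3 * v) * mean n r (\<lambda>x. (A x)\<^sup>2 * (D x)\<^sup>2) +
      (2 * \<rho> ^ 3 * v + \<rho> ^ 4 * v) * mean n r (\<lambda>x. (D x) ^ 4)"
    by (simp only: mean_simps)
  also have "\<dots> \<le> \<alpha>\<^sup>2 + (6 * \<rho>\<^sup>2 * v + 2 * \<rho> ^ 3 * v) * (\<alpha> * \<beta>) + (2 * \<rho> ^ 3 * v + \<rho> ^ 4 * v) * \<beta>\<^sup>2"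
    using rho v lam by (intro add_mono mult_left_mono A4 A2D2 D4) auto
  \<comment> \<open>Compare coefficients with the square of \<open>\<alpha> + v * \<beta>\<close>.
    The last one needs \<open>2 * \<rho> ^ 3 + \<rho> ^ 4 \<le> \<rho> \<le> \<kappa> / 2 \<le>
    v\<close>, which is where the bound on \<open>\<rho>\<close> enters.\<close>
  also have "\<dots> \<le> \<alpha>\<^sup>2 + (2 * v) * (\<alpha> * \<beta>) + v\<^sup>2 * \<beta>\<^sup>2"
  proof -
    have r14: "\<rho> \<le> 1/4" using rho lam by simp
    have p2: "\<rho>\<^sup>2 \<le> (1/4)\<^sup>2" and p3: "\<rho> ^ 3 \<le> (1/4) ^ 3"
      using rho r14 by (auto intro: power_mono)
    have "6 * \<rho>\<^sup>2 + 2 * \<rho> ^ 3 \<le> 2" using p2 p3 by (simp add: power2_eq_square power3_eq_cube)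
    then have 1: "(6 * \<rho>\<^sup>2 + 2 * \<rho> ^ 3) * v \<le> 2 * v" using v lam by (intro mult_right_mono) auto
    have "\<rho> ^ 3 = \<rho>\<^sup>2 * \<rho>" "\<rho> ^ 4 = \<rho> ^ 3 * \<rho>" by (simp_all add: power2_eq_square power3_eq_cube power4_eq_xxxx)
    then have "\<rho> ^ 3 \<le> (1/4)\<^sup>2 * \<rho>" "\<rho> ^ 4 \<le> (1/4) ^ 3 * \<rho>"
      using mult_right_mono[OF p2, of \<rho>] mult_right_mono[OF p3, of \<rho>] rho by auto
    then have "2 * \<rho> ^ 3 + \<rho> ^ 4 \<le> \<rho>" using rho by (simp add: power2_eq_square power3_eq_cube)
    then have "2 * \<rho> ^ 3 + \<rho> ^ 4 \<le> v" using rho v by simp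
    then have 2: "(2 * \<rho> ^ 3 + \<rho> ^ 4) * v \<le> v * v" using v lam by (intro mult_right_mono) auto
    show ?thesis using 1 2 ab0
      by (intro add_mono mult_right_mono) (auto simp: algebra_simps power2_eq_square)
  qed
  also have "\<dots> = (\<alpha> + v * \<beta>)\<^sup>2" by (simp add: power2_eq_square algebra_simps)
  also have "\<alpha> + v * \<beta> = mean (Suc n) r (\<lambda>x. (f x)\<^sup>2)"
  proof -
    have "mean (Suc n) r (\<lambda>x. (f x)\<^sup>2) = mean n r (\<lambda>y. r * (fT y)\<^sup>2 + (1 - r) * (fF y)\<^sup>2)"
      by (simp only: mean_Suc mean_simps fT_def fF_def)
    also have "(\<lambda>y. r * (fT y)\<^sup>2 + (1 - r) * (fF y)\<^sup>2) = (\<lambda>y. (a y)\<^sup>2 + v * (d y)\<^sup>2)"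
      unfolding a_def d_def v_def by (auto simp: power2_eq_square algebra_simps)
    finally show ?thesis by (simp only: mean_simps \<alpha>_def \<beta>_def)
  qed
  finally show ?case .
qed

section \<open>Heat flow estimates and resampling variance\<close>

lemma square_le_abs:
  fixes a :: real
  assumes "\<bar>a\<bar> \<le> 1"
  shows "a\<^sup>2 \<le> \<bar>a\<bar>"
proof -
  have "a\<^sup>2 = \<bar>a\<bar> * \<bar>a\<bar>" by (simp add: power2_eq_square)
  also have "\<dots> \<le> \<bar>a\<bar>" by (rule mult_left_le[OF assms abs_ge_zero])
  finally show ?thesis .
qed

text \<open>The dual of hypercontractivity, for functions bounded by 1. Two applications of
  Cauchy-Schwarz give \<open>X\<^sup>2 \<le> e * Y\<close> and \<open>Y \<le> sqrt e * X\<close>,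
  from which one factor \<open>X\<close> cancels.\<close>

lemma noise_square_le_L1:
  assumes kap: "0 < \<kappa>" "\<kappa> \<le> 1/2" and r: "\<kappa> \<le> r" "r \<le> 1 - \<kappa>" and rho: "0 \<le> \<rho>" "\<rho> \<le> \<kappa> / 2"
    and u: "\<And>x. \<bar>u x\<bar> \<le> 1"
  shows "mean n r (\<lambda>x. (noise n r \<rho> u x)\<^sup>2) \<le> mean n r (\<lambda>x. \<bar>u x\<bar>) powr (3/2)"
proof -
  have r01: "0 \<le> r" "r \<le> 1" using kap r by auto
  define w where "w = noise n r \<rho> (noise n r \<rho> u)"
  define e X Y where "e = mean n r (\<lambda>x. \<bar>u x\<bar>)" and "X = mean n r (\<lambda>x. (noise n r \<rho> u x)\<^sup>2)"
    and "Y = mean n r (\<lambda>x. \<bar>u x\<bar> * (w x)\<^sup>2)"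
  have nn: "0 \<le> e" "0 \<le> X" "0 \<le> Y" unfolding e_def X_def Y_def by (auto intro!: mean_nonneg r01)
  have X: "X = mean n r (\<lambda>x. u x * w x)"
    unfolding w_def X_def by (subst mean_noise_adjoint) (simp add: power2_eq_square)
  have "X\<^sup>2 \<le> e * Y"
  proof -
    have eq: "sqrt \<bar>a\<bar> * (sgn a * sqrt \<bar>a\<bar> * b) = a * b" for a b :: real
    proof -
      have "sqrt \<bar>a\<bar> * (sgn a * sqrt \<bar>a\<bar> * b) = sgn a * (sqrt \<bar>a\<bar> * sqrt \<bar>a\<bar>) * b" by (simp add: mult_ac)
      also have "\<dots> = a * b" by (simp add: sgn_mult_abs)
      finally show ?thesis .
    qed
    have eq2: "(sgn a * sqrt \<bar>a\<bar> * b)\<^sup>2 = \<bar>a\<bar> * b\<^sup>2" for a b :: real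
      by (cases "a = 0") (simp_all add: power_mult_distrib sgn_if)
    \<comment> \<open>Split \<open>u\<close> into two factors of size
      \<open>sqrt \<bar>u x\<bar>\<close>, so that \<open>w\<close> is measured with weight
      \<open>\<bar>u x\<bar>\<close>.\<close>
    have "(mean n r (\<lambda>x. sqrt \<bar>u x\<bar> * (sgn (u x) * sqrt \<bar>u x\<bar> * w x)))\<^sup>2 \<le>
       mean n r (\<lambda>x. (sqrt \<bar>u x\<bar>)\<^sup>2) * mean n r (\<lambda>x. (sgn (u x) * sqrt \<bar>u x\<bar> * w x)\<^sup>2)"
      by (rule mean_cauchy_schwarz[OF r01])
    then show ?thesis unfolding eq eq2 by (simp add: X e_def Y_def)
  qed
  have "Y\<^sup>2 \<le> e * X\<^sup>2"
  proof -
    have "Y\<^sup>2 \<le> mean n r (\<lambda>x. \<bar>u x\<bar>\<^sup>2) * mean n r (\<lambda>x. ((w x)\<^sup>2)\<^sup>2)"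
      unfolding Y_def by (rule mean_cauchy_schwarz[OF r01])
    also have "\<dots> \<le> e * X\<^sup>2"
    proof (rule mult_mono)
      have "\<bar>u x\<bar>\<^sup>2 \<le> \<bar>u x\<bar>" for x by (subst power2_abs) (rule square_le_abs[OF u])
      then show "mean n r (\<lambda>x. \<bar>u x\<bar>\<^sup>2) \<le> e" unfolding e_def by (rule mean_mono[OF r01])
      \<comment> \<open>Hypercontractivity is applied to \<open>noise n r \<rho> u\<close>, whose
        squared norm is \<open>X\<close>.\<close>
      have "mean n r (\<lambda>x. (w x) ^ 4) \<le> X\<^sup>2"
        unfolding w_def X_def by (rule hypercontractive_2_4[OF kap r rho])
      then show "mean n r (\<lambda>x. ((w x)\<^sup>2)\<^sup>2) \<le> X\<^sup>2" by simp
    qed (auto intro!: mean_nonneg r01 nn)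
    finally show ?thesis .
  qed
  also have "e * X\<^sup>2 = (sqrt e * X)\<^sup>2" using nn by (simp add: power_mult_distrib)
  finally have "Y \<le> sqrt e * X" by (rule power2_le_imp_le) (use nn in simp)
  then have "e * Y \<le> e * (sqrt e * X)" by (rule mult_left_mono[OF _ nn(1)])
  with \<open>X\<^sup>2 \<le> e * Y\<close> have "X * X \<le> (e * sqrt e) * X"
    unfolding power2_eq_square mult.assoc by (rule order_trans)
  then have "X \<le> e * sqrt e"
  proof (cases "X = 0")
    case False
    with nn have "0 < X" by simp
    with \<open>X * X \<le> (e * sqrt e) * X\<close> show ?thesis by (rule mult_right_le_imp_le)
  qed (use nn in simp)
  also have "e * sqrt e = e powr (3/2)"
  proof (cases "e = 0")
    case False
    then have "e powr (1 + 1/2) = e * sqrt e" using nn by (subst powr_add) (simp add: powr_half_sqrt)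
    then show ?thesis by simp
  qed simp
  finally show ?thesis by (simp add: X_def e_def)
qed

text \<open>Halving the time costs a square root, by log-convexity of the heat flow.\<close>

lemma noise_square_le_powr:
  assumes kap: "0 < \<kappa>" "\<kappa> \<le> 1/2" and r: "\<kappa> \<le> r" "r \<le> 1 - \<kappa>"
    and rho: "0 \<le> \<rho>" "\<rho> ^ 2 ^ k \<le> \<kappa> / 2" and u: "\<And>x. \<bar>u x\<bar> \<le> 1"
  shows "mean n r (\<lambda>x. (noise n r \<rho> u x)\<^sup>2) \<le> mean n r (\<lambda>x. \<bar>u x\<bar>) powr (1 + 1 / 2 ^ Suc k)"
  using rho
proof (induction k arbitrary: \<rho>)
  case 0
  then have "\<rho> \<le> \<kappa> / 2" by simp
  from noise_square_le_L1[OF kap r 0(1) this u] show ?case by simp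
next
  case (Suc k)
  have r01: "0 \<le> r" "r \<le> 1" using kap r by auto
  define e X where "e = mean n r (\<lambda>x. \<bar>u x\<bar>)" and "X = mean n r (\<lambda>x. (noise n r \<rho> u x)\<^sup>2)"
  have nn: "0 \<le> e" "0 \<le> X" unfolding e_def X_def by (auto intro!: mean_nonneg r01)
  \<comment> \<open>Self-adjointness trades the squared norm at \<open>\<rho>\<close> for an inner
    product at \<open>\<rho> * \<rho>\<close>; Cauchy-Schwarz then reaches the induction
    hypothesis.\<close>
  have "X = mean n r (\<lambda>x. u x * noise n r (\<rho> * \<rho>) u x)"
    unfolding noise_noise[symmetric] X_def by (subst mean_noise_adjoint) (simp add: power2_eq_square)
  then have "X\<^sup>2 \<le> mean n r (\<lambda>x. (u x)\<^sup>2) * mean n r (\<lambda>x. (noise n r (\<rho> * \<rho>) u x)\<^sup>2)"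
    using mean_cauchy_schwarz[OF r01] by simp
  also have "\<dots> \<le> e * e powr (1 + 1 / 2 ^ Suc k)"
  proof (rule mult_mono)
    have "(u x)\<^sup>2 \<le> \<bar>u x\<bar>" for x by (rule square_le_abs[OF u])
    then show "mean n r (\<lambda>x. (u x)\<^sup>2) \<le> e" unfolding e_def by (rule mean_mono[OF r01])
    show "mean n r (\<lambda>x. (noise n r (\<rho> * \<rho>) u x)\<^sup>2) \<le> e powr (1 + 1 / 2 ^ Suc k)"
      unfolding e_def
    proof (rule Suc.IH)
      show "(\<rho> * \<rho>) ^ 2 ^ k \<le> \<kappa> / 2" using Suc.prems(2)
        by (simp add: power2_eq_square[symmetric] power_mult[symmetric])
    qed simp
  qed (auto intro!: mean_nonneg r01 nn)
  also have "\<dots> = (e powr (1 + 1 / 2 ^ Suc (Suc k)))\<^sup>2"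
  proof (cases "e = 0")
    case False
    then have "e * e powr (1 + 1 / 2 ^ Suc k) = e powr 1 * e powr (1 + 1 / 2 ^ Suc k)" using nn by simp
    also have "\<dots> = e powr (1 + (1 + 1 / 2 ^ Suc k))" by (rule powr_add[symmetric])
    also have "(1::real) + (1 + 1 / 2 ^ Suc k) = (1 + 1 / 2 ^ Suc (Suc k)) + (1 + 1 / 2 ^ Suc (Suc k))"
      by simp
    also have "e powr \<dots> = (e powr (1 + 1 / 2 ^ Suc (Suc k)))\<^sup>2"
      unfolding power2_eq_square by (rule powr_add)
    finally show ?thesis .
  qed simp
  finally have "X \<le> e powr (1 + 1 / 2 ^ Suc (Suc k))" by (rule power2_le_imp_le) simp
  then show ?case by (simp add: X_def e_def)
qed

lemma noise_bounds:
  assumes "0 \<le> r" "r \<le> 1" "0 \<le> \<rho>" "\<rho> \<le> 1" "\<And>x. 0 \<le> f x" "\<And>x. f x \<le> 1"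
  shows "0 \<le> noise n r \<rho> f x" "noise n r \<rho> f x \<le> 1"
  using assms unfolding noise_def by (auto intro!: kop_nonneg kop_le_const stoch_noise)

lemma resamp_bounds:
  assumes "0 \<le> r" "r \<le> 1" "\<And>x. 0 \<le> f x" "\<And>x. f x \<le> 1"
  shows "0 \<le> resamp n r B f x" "resamp n r B f x \<le> 1"
  using assms unfolding resamp_def by (auto intro!: kop_nonneg kop_le_const stoch_resamp)

text \<open>A telescoping union bound over \<open>m\<close> noise steps. The extra term measures how
  far \<open>h\<close> is from Boolean and vanishes for indicators.\<close>

lemma noise_sensitivity_power:
  assumes r: "0 \<le> r" "r \<le> 1" and rho: "0 \<le> \<rho>" "\<rho> \<le> 1" and h: "\<And>x. 0 \<le> h x" "\<And>x. h x \<le> 1"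
  shows "mean n r (\<lambda>x. h x * (1 - noise n r (\<rho> ^ m) h x)) \<le>
    mean n r (\<lambda>x. h x * (1 - h x)) + real m * mean n r (\<lambda>x. h x * (1 - noise n r \<rho> h x))"
proof (induction m)
  case 0
  then show ?case by (simp add: noise_1)
next
  case (Suc m)
  define T where "T = noise n r (\<rho> ^ m) h"
  have rm: "0 \<le> \<rho> ^ m" "\<rho> ^ m \<le> 1" using rho by (auto intro: power_le_one)
  have T: "0 \<le> T x" "T x \<le> 1" for x
    unfolding T_def using noise_bounds[OF r rm h] by auto
  have N: "0 \<le> noise n r \<rho> h x" "noise n r \<rho> h x \<le> 1" for x
    using noise_bounds[OF r rho h] by auto
  have "mean n r (\<lambda>x. h x * (1 - noise n r (\<rho> ^ Suc m) h x)) =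
    mean n r (\<lambda>x. h x * (1 - T x)) + mean n r (\<lambda>x. h x * noise n r (\<rho> ^ m) (\<lambda>y. h y - noise n r \<rho> h y) x)"
    unfolding mean_simps[symmetric] noise_diff noise_noise T_def by (simp add: algebra_simps)
  also have "mean n r (\<lambda>x. h x * noise n r (\<rho> ^ m) (\<lambda>y. h y - noise n r \<rho> h y) x) =
     mean n r (\<lambda>x. T x * (h x - noise n r \<rho> h x))"
    unfolding T_def by (rule mean_noise_adjoint)
  also have "\<dots> \<le> mean n r (\<lambda>x. h x * (1 - noise n r \<rho> h x))"
  proof (rule mean_mono[OF r])
    fix x
    \<comment> \<open>The difference of the two sides is
      \<open>noise n r \<rho> h x * (1 - h x)\<close>, which is nonnegative.\<close>
    have "h x - noise n r \<rho> h x \<le> h x * (1 - noise n r \<rho> h x)"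
      using mult_left_le_one_le[of "noise n r \<rho> h x" "h x"] N h by (simp add: algebra_simps)
    then have "T x * (h x - noise n r \<rho> h x) \<le> T x * (h x * (1 - noise n r \<rho> h x))"
      using T by (intro mult_left_mono) auto
    also have "\<dots> \<le> 1 * (h x * (1 - noise n r \<rho> h x))"
      using T N h by (intro mult_right_mono) auto
    finally show "T x * (h x - noise n r \<rho> h x) \<le> h x * (1 - noise n r \<rho> h x)" by simp
  qed
  finally show ?case using Suc.IH by (simp add: T_def algebra_simps)
qed

text \<open>Diminishing returns: the variance lost by resampling coordinate \<open>i\<close> decreases
  with the set of coordinates already resampled.\<close>

lemma resamp_variance_covering:
  assumes r: "0 \<le> r" "r \<le> 1" and al: "0 \<le> \<alpha>" "\<alpha> \<le> 1" and w: "\<And>B. 0 \<le> w B"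
    and cover: "\<And>i. i < n \<Longrightarrow> i \<notin> J \<Longrightarrow> c \<le> mean n \<alpha> (\<lambda>B. w B * of_bool (B i))"
  shows "c * mean n r (\<lambda>x. (g x - resamp n r (\<lambda>i. i \<notin> J) g x)\<^sup>2) \<le>
     mean n \<alpha> (\<lambda>B. w B * mean n r (\<lambda>x. (g x - resamp n r B g x)\<^sup>2))"
proof -
  define s where "s X = mean n r (\<lambda>x. (resamp n r X g x)\<^sup>2)" for X
  \<comment> \<open>The coordinates outside \<open>J\<close> are resampled one at a time in
    increasing order; \<open>S i\<close> holds those done before \<open>i\<close>, and
    \<open>\<delta> i\<close> is the energy lost at \<open>i\<close>.\<close>
  define S where "S i = (\<lambda>j. j < i \<and> j \<notin> J)" for i :: nat
  define \<delta> where "\<delta> i = s (S i) - s (S (Suc i))" for i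
  define D where "D i = (\<lambda>x. g x - resamp n r (\<lambda>j. j = i) g x)" for i
  have s_step: "s X - s (\<lambda>j. X j \<or> j = i) = mean n r (\<lambda>x. (resamp n r X (D i) x)\<^sup>2)" for X i
  proof -
    have "s X - s (\<lambda>j. X j \<or> j = i) = mean n r (\<lambda>x. (resamp n r X g x)\<^sup>2) -
        mean n r (\<lambda>x. (resamp n r (\<lambda>j. j = i) (resamp n r X g) x)\<^sup>2)"
      unfolding s_def resamp_resamp by (simp add: disj_commute)
    also have "\<dots> = mean n r (\<lambda>x. (resamp n r X g x - resamp n r (\<lambda>j. j = i) (resamp n r X g) x)\<^sup>2)"
      by (rule mean_resamp_diff_square[symmetric])
    also have "\<dots> = mean n r (\<lambda>x. (resamp n r X (D i) x)\<^sup>2)"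
      unfolding D_def resamp_diff resamp_resamp by (simp add: disj_commute)
    finally show ?thesis .
  qed
  have s_anti: "s Y \<le> s X" if "\<And>j. X j \<Longrightarrow> Y j" for X Y
  proof -
    have "resamp n r Y g = resamp n r Y (resamp n r X g)"
      unfolding resamp_resamp using that by (intro resamp_cong) auto
    then show ?thesis unfolding s_def using mean_resamp_contract[OF r, of n Y "resamp n r X g"] by simp
  qed
  have \<delta>0: "0 \<le> \<delta> i" for i unfolding \<delta>_def using s_anti[of "S i" "S (Suc i)"] by (auto simp: S_def)
  have \<delta>J: "\<delta> i = 0" if "i \<in> J" for i
  proof -
    have "S (Suc i) = S i" using that by (auto simp: S_def less_Suc_eq)
    then show ?thesis by (simp add: \<delta>_def)
  qed
  have var: "mean n r (\<lambda>x. (g x - resamp n r B g x)\<^sup>2) = s (\<lambda>_. False) - s B" for B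
    unfolding mean_resamp_diff_square s_def by (simp add: resamp_none)
  have pt: "(\<Sum>i<n. of_bool (B i) * \<delta> i) \<le> s (\<lambda>_. False) - s B" for B
  proof -
    define X where "X i = (\<lambda>j. j < i \<and> j \<notin> J \<and> B j)" for i :: nat
    have "of_bool (B i) * \<delta> i \<le> s (X i) - s (X (Suc i))" for i
    proof (cases "B i \<and> i \<notin> J")
      case True
      then have eq: "X (Suc i) = (\<lambda>j. X i j \<or> j = i)" "S (Suc i) = (\<lambda>j. S i j \<or> j = i)"
        by (auto simp: X_def S_def less_Suc_eq)
      \<comment> \<open>\<open>X i\<close> is contained in \<open>S i\<close>, so resampling
        \<open>S i\<close> factors through \<open>X i\<close> and contracts: the loss at
        \<open>i\<close> is larger along \<open>B\<close>.\<close>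
      have "resamp n r (S i) (D i) = resamp n r (S i) (resamp n r (X i) (D i))"
        unfolding resamp_resamp by (intro resamp_cong) (auto simp: X_def S_def)
      then have "\<delta> i \<le> s (X i) - s (X (Suc i))"
        unfolding \<delta>_def eq s_step using mean_resamp_contract[OF r, of n "S i" "resamp n r (X i) (D i)"] by simp
      then show ?thesis using True by simp
    next
      case False
      then have "of_bool (B i) * \<delta> i = 0" using \<delta>J by auto
      moreover have "X (Suc i) = X i" using False by (auto simp: X_def less_Suc_eq)
      ultimately show ?thesis by simp
    qed
    then have "(\<Sum>i<n. of_bool (B i) * \<delta> i) \<le> (\<Sum>i<n. s (X i) - s (X (Suc i)))"
      by (rule sum_mono)
    also have "\<dots> = s (X 0) - s (X n)" by (rule sum_lessThan_telescope')
    also have "\<dots> \<le> s (\<lambda>_. False) - s B"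
      using s_anti[of "X n" B] by (auto simp: X_def)
    finally show ?thesis .
  qed
  have "c * (s (\<lambda>_. False) - s (\<lambda>i. i \<notin> J)) = (\<Sum>i<n. c * \<delta> i)"
  proof -
    have "(\<Sum>i<n. \<delta> i) = s (S 0) - s (S n)" unfolding \<delta>_def by (rule sum_lessThan_telescope')
    moreover have "s (S n) = s (\<lambda>i. i \<notin> J)" unfolding s_def
      by (subst resamp_cong[of n "S n" "\<lambda>i. i \<notin> J"]) (auto simp: S_def)
    ultimately show ?thesis by (simp add: S_def sum_distrib_left[symmetric])
  qed
  \<comment> \<open>Outside \<open>J\<close> each coordinate is covered with weight at least
    \<open>c\<close>; inside \<open>J\<close> both sides vanish.\<close>
  also have "\<dots> \<le> (\<Sum>i<n. mean n \<alpha> (\<lambda>B. w B * of_bool (B i)) * \<delta> i)"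
  proof (rule sum_mono)
    fix i assume "i \<in> {..<n}"
    then show "c * \<delta> i \<le> mean n \<alpha> (\<lambda>B. w B * of_bool (B i)) * \<delta> i"
      using cover[of i] \<delta>0[of i] \<delta>J[of i] by (cases "i \<in> J") (auto intro: mult_right_mono)
  qed
  also have "\<dots> = mean n \<alpha> (\<lambda>B. \<Sum>i<n. w B * of_bool (B i) * \<delta> i)"
    unfolding mean_sum mean_simps(4) ..
  also have "\<dots> = mean n \<alpha> (\<lambda>B. w B * (\<Sum>i<n. of_bool (B i) * \<delta> i))"
    by (simp only: sum_distrib_left mult.assoc)
  also have "\<dots> \<le> mean n \<alpha> (\<lambda>B. w B * (s (\<lambda>_. False) - s B))"
    by (intro mean_mono[OF al] mult_left_mono pt w)
  finally show ?thesis unfolding var .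
qed

lemma mean_coord: "i < n \<Longrightarrow> 0 \<le> \<alpha> \<Longrightarrow> \<alpha> \<le> 1 \<Longrightarrow> mean n \<alpha> (\<lambda>B. of_bool (B i)) = \<alpha>"
  by (induction n) (auto simp: mean_Suc mean_const less_Suc_eq algebra_simps)

lemma mean_coord2:
  "i < n \<Longrightarrow> j < n \<Longrightarrow> i \<noteq> j \<Longrightarrow> 0 \<le> \<alpha> \<Longrightarrow> \<alpha> \<le> 1 \<Longrightarrow>
   mean n \<alpha> (\<lambda>B. of_bool (B i) * of_bool (B j)) = \<alpha>\<^sup>2"
  by (induction n)
    (auto simp: mean_Suc mean_const mean_coord less_Suc_eq power2_eq_square algebra_simps)

section \<open>Noise-stable functions are close to juntas\<close>

lemma kop_swap: "kop n k (\<lambda>x. kop m k' (F x) z) x0 = kop m k' (\<lambda>y. kop n k (\<lambda>x. F x y) x0) z"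
proof (induction m arbitrary: F)
  case (Suc m)
  show ?case by (simp add: kop_add kop_cmult Suc.IH)
qed simp

lemma mean_swap: "mean n \<alpha> (\<lambda>B. mean m r (F B)) = mean m r (\<lambda>x. mean n \<alpha> (\<lambda>B. F B x))"
  unfolding mean_def by (rule kop_swap)

text \<open>For an indicator, the absolute difference is
  \<open>2 * (h x * (1 - resamp n r B h x))\<close> minus the signed difference, and the signed
  difference has mean zero.\<close>

lemma L1_resamp_indicator:
  assumes r: "0 \<le> r" "r \<le> 1" and h: "\<And>x. h x = 0 \<or> h x = (1::real)"
  shows "mean n r (\<lambda>x. \<bar>h x - resamp n r B h x\<bar>) = 2 * mean n r (\<lambda>x. h x * (1 - resamp n r B h x))"
proof -
  have h01: "0 \<le> h x" "h x \<le> 1" for x using h[of x] by auto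
  have "\<bar>h x - resamp n r B h x\<bar> = 2 * (h x * (1 - resamp n r B h x)) - (h x - resamp n r B h x)" for x
    using h[of x] resamp_bounds[OF r h01, where n = n and B = B and x = x] by auto
  then have "mean n r (\<lambda>x. \<bar>h x - resamp n r B h x\<bar>) =
      2 * mean n r (\<lambda>x. h x * (1 - resamp n r B h x)) - (mean n r h - mean n r (resamp n r B h))"
    by (simp only: mean_simps)
  then show ?thesis by (simp add: mean_resamp)
qed

text \<open>A second factorial moment: the integrand counts ordered pairs of distinct elements of
  \<open>P\<close> that both lie in \<open>B\<close>.\<close>

lemma mean_card_square:
  assumes P: "P \<subseteq> {..<n}" "card P = l" and al: "0 \<le> \<alpha>" "\<alpha> \<le> 1"
  defines "N \<equiv> (\<lambda>B. \<Sum>i\<in>P. of_bool (B i) :: real)"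
  shows "mean n \<alpha> (\<lambda>B. (N B)\<^sup>2 - N B) \<le> (real l)\<^sup>2 * \<alpha>\<^sup>2"
proof -
  have fin: "finite P" using P(1) finite_subset by blast
  have "(N B)\<^sup>2 - N B = (\<Sum>i\<in>P. \<Sum>j\<in>P. if i = j then 0 else of_bool (B i) * of_bool (B j))" for B
  proof -
    have "(N B)\<^sup>2 - N B = (\<Sum>i\<in>P. (\<Sum>j\<in>P. of_bool (B i) * of_bool (B j)) - of_bool (B i))"
      unfolding N_def power2_eq_square sum_product sum_subtractf ..
    also have "\<dots> = (\<Sum>i\<in>P. \<Sum>j\<in>P. if i = j then 0 else of_bool (B i) * of_bool (B j))"
    proof (rule sum.cong[OF refl])
      fix i assume i: "i \<in> P"
      have "(\<Sum>j\<in>P. of_bool (B i) * of_bool (B j) :: real) - of_bool (B i) =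
         (\<Sum>j\<in>P. of_bool (B i) * of_bool (B j) - (if i = j then of_bool (B i) else 0))"
        unfolding sum_subtractf using i fin by (simp add: sum.delta')
      also have "\<dots> = (\<Sum>j\<in>P. if i = j then 0 else of_bool (B i) * of_bool (B j))"
        by (rule sum.cong[OF refl]) auto
      finally show "(\<Sum>j\<in>P. of_bool (B i) * of_bool (B j) :: real) - of_bool (B i) =
         (\<Sum>j\<in>P. if i = j then 0 else of_bool (B i) * of_bool (B j))" .
    qed
    finally show ?thesis .
  qed
  then have "mean n \<alpha> (\<lambda>B. (N B)\<^sup>2 - N B) =
     (\<Sum>i\<in>P. \<Sum>j\<in>P. mean n \<alpha> (\<lambda>B. if i = j then 0 else of_bool (B i) * of_bool (B j)))"
    by (simp only: mean_sum)
  also have "\<dots> \<le> (\<Sum>i\<in>P. \<Sum>j\<in>P. \<alpha>\<^sup>2)"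
  proof (intro sum_mono)
    fix i j assume "i \<in> P" "j \<in> P"
    then show "mean n \<alpha> (\<lambda>B. if i = j then 0 else of_bool (B i) * of_bool (B j)) \<le> \<alpha>\<^sup>2"
      using mean_coord2[OF _ _ _ al, of i n j] P(1) al by (cases "i = j") (auto simp: mean_const subset_iff)
  qed
  also have "\<dots> = (real l)\<^sup>2 * \<alpha>\<^sup>2" using P by (simp add: power2_eq_square)
  finally show ?thesis .
qed

text \<open>Two elements of a bounded set of coordinates are rarely in the same random set of small density.\<close>

lemma few_popular_coordinates:
  assumes P: "P \<subseteq> {..<n}" "card P = l" and al: "0 < \<alpha>" "\<alpha> \<le> 1" and tau: "0 < \<tau>"
    and I: "\<And>B. 0 \<le> I B" "mean n \<alpha> I \<le> C * \<alpha>"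
    and pop: "\<And>i. i \<in> P \<Longrightarrow> \<alpha> / 2 \<le> mean n \<alpha> (\<lambda>B. of_bool (\<tau> \<le> I B) * of_bool (B i))"
  shows "real l / 2 \<le> C / \<tau> + (real l)\<^sup>2 * \<alpha>"
proof -
  have al': "0 \<le> \<alpha>" "\<alpha> \<le> 1" using al by auto
  define N :: "(nat \<Rightarrow> bool) \<Rightarrow> real" where "N B = (\<Sum>i\<in>P. of_bool (B i))" for B
  have N: "N B = real (card {i\<in>P. B i})" for B
    using P finite_subset[OF P(1)] by (simp add: N_def Int_def)
  have "real l * (\<alpha> / 2) = (\<Sum>i\<in>P. \<alpha> / 2)" using P by simp
  also have "\<dots> \<le> (\<Sum>i\<in>P. mean n \<alpha> (\<lambda>B. of_bool (\<tau> \<le> I B) * of_bool (B i)))"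
    by (rule sum_mono) (rule pop)
  also have "\<dots> = mean n \<alpha> (\<lambda>B. of_bool (\<tau> \<le> I B) * N B)"
    unfolding mean_sum[symmetric] N_def sum_distrib_left ..
  \<comment> \<open>One element of \<open>P\<close> in \<open>B\<close> is charged to the event
    \<open>\<tau> \<le> I B\<close>, by Markov's inequality; any further ones are charged to
    pairs.\<close>
  also have "\<dots> \<le> mean n \<alpha> (\<lambda>B. 1 / \<tau> * I B + ((N B)\<^sup>2 - N B))"
  proof (rule mean_mono[OF al'])
    fix B
    have 1: "0 \<le> (N B)\<^sup>2 - N B"
      unfolding N power2_eq_square by (cases "card {i\<in>P. B i}") auto
    have 2: "N B \<le> 1 + ((N B)\<^sup>2 - N B)"
      using zero_le_power2[of "N B - 1"] by (simp add: power2_eq_square algebra_simps)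
    show "of_bool (\<tau> \<le> I B) * N B \<le> 1 / \<tau> * I B + ((N B)\<^sup>2 - N B)"
    proof (cases "\<tau> \<le> I B")
      case True
      then have "1 \<le> 1 / \<tau> * I B" using tau by (simp add: field_simps)
      then show ?thesis using 2 True by simp
    next
      case False
      then show ?thesis using 1 tau I(1)[of B] by simp
    qed
  qed
  also have "\<dots> = 1 / \<tau> * mean n \<alpha> I + mean n \<alpha> (\<lambda>B. (N B)\<^sup>2 - N B)" by (simp only: mean_simps)
  also have "\<dots> \<le> 1 / \<tau> * (C * \<alpha>) + (real l)\<^sup>2 * \<alpha>\<^sup>2"
    using I(2) tau mean_card_square[OF P al'] unfolding N_def
    by (intro add_mono mult_left_mono) auto
  finally have "\<alpha> * (real l / 2) \<le> \<alpha> * (C / \<tau> + (real l)\<^sup>2 * \<alpha>)"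
    by (simp add: power2_eq_square algebra_simps)
  then show ?thesis using al by simp
qed

text \<open>The average influence of a random set is at most \<open>C * \<alpha>\<close>, while a
  coordinate outside \<open>J\<close> lies in an uninfluential set with probability at least
  \<open>\<alpha> / 2\<close>. These two factors \<open>\<alpha>\<close> cancel, so the variance of
  the smoothed function outside \<open>J\<close> is bounded independently of
  \<open>\<alpha>\<close>; hypercontractivity supplies the small factor.\<close>

lemma noise_stable_junta_step:
  assumes kap: "0 < \<kappa>" "\<kappa> \<le> 1/2" and r: "\<kappa> \<le> r" "r \<le> 1 - \<kappa>" and al: "0 < \<alpha>" "\<alpha> \<le> 1"
    and h: "\<And>x. h x = 0 \<or> h x = (1::real)"
    and stable: "mean n r (\<lambda>x. h x * (1 - noise n r (1 - \<alpha>) h x)) \<le> C * \<alpha>"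
    and m: "(1 - \<alpha>) ^ (m * 2 ^ k) \<le> \<kappa> / 2" and tau: "0 < \<tau>"
    and l: "4 * C / \<tau> < real l" "\<alpha> \<le> 1 / (4 * real l)"
  shows "\<exists>J \<subseteq> {..<n}. card J \<le> l \<and>
    mean n r (\<lambda>x. (h x - resamp n r (\<lambda>i. i \<notin> J) h x)\<^sup>2) \<le>
      4 * real m * (C * \<alpha>) + 8 * C * (2 * \<tau>) powr (1 / 2 ^ Suc k)"
proof -
  have r01: "0 \<le> r" "r \<le> 1" using kap r by auto
  have al': "0 \<le> \<alpha>" "\<alpha> \<le> 1" using al by auto
  have h01: "0 \<le> h x" "h x \<le> 1" for x using h[of x] by auto
  \<comment> \<open>\<open>I B\<close> is the influence of the whole set \<open>B\<close>: half the
    L1 distance moved by resampling it.\<close>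
  define I where "I B = mean n r (\<lambda>x. h x * (1 - resamp n r B h x))" for B
  have I0: "0 \<le> I B" for B
    unfolding I_def using resamp_bounds[OF r01 h01] h01 by (intro mean_nonneg r01 mult_nonneg_nonneg) auto
  have mean_I: "mean n \<alpha> I \<le> C * \<alpha>"
  proof -
    have "mean n \<alpha> I = mean n r (\<lambda>x. h x * (1 - noise n r (1 - \<alpha>) h x))"
    proof -
      have "mean n \<alpha> I = mean n r (\<lambda>x. mean n \<alpha> (\<lambda>B. h x * (1 - resamp n r B h x)))"
        unfolding I_def by (rule mean_swap)
      also have "\<dots> = mean n r (\<lambda>x. h x * (1 - mean n \<alpha> (\<lambda>B. resamp n r B h x)))"
        by (simp only: mean_simps mean_const[OF al'])
      finally show ?thesis by (simp only: mean_resamp_mixture)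
    qed
    with stable show ?thesis by simp
  qed
  \<comment> \<open>The popular coordinates: conditionally on containing \<open>i\<close>, a random
    set is influential with probability at least one half.\<close>
  define J where "J = {i. i < n \<and> \<alpha> / 2 \<le> mean n \<alpha> (\<lambda>B. of_bool (\<tau> \<le> I B) * of_bool (B i))}"
  have J: "J \<subseteq> {..<n}" by (auto simp: J_def)
  have cardJ: "card J \<le> l"
  proof (rule ccontr)
    assume "\<not> card J \<le> l"
    then obtain P where P: "P \<subseteq> J" "card P = l" using obtain_subset_with_card_n[of l J] by auto
    have "real l / 2 \<le> C / \<tau> + (real l)\<^sup>2 * \<alpha>"
      by (rule few_popular_coordinates[OF _ P(2) al tau I0 mean_I]) (use P J in \<open>auto simp: J_def\<close>)
    also have "(real l)\<^sup>2 * \<alpha> \<le> (real l)\<^sup>2 * (1 / (4 * real l))"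
      using l by (intro mult_left_mono) auto
    also have "\<dots> = real l / 4" by (simp add: power2_eq_square)
    finally show False using l by simp
  qed
  \<comment> \<open>Hypercontractivity needs smoothing, so the variance is estimated for
    \<open>g\<close>, which stays close to \<open>h\<close> by stability.\<close>
  define g where "g = noise n r ((1 - \<alpha>) ^ m) h"
  define w :: "(nat \<Rightarrow> bool) \<Rightarrow> real" where "w B = of_bool (I B < \<tau>)" for B
  define \<theta> :: real where "\<theta> = 1 / 2 ^ Suc k"
  have rho: "0 \<le> (1 - \<alpha>) ^ m" "(1 - \<alpha>) ^ m \<le> 1" using al by (auto intro: power_le_one)
  have gP: "mean n r (\<lambda>x. (g x - resamp n r B g x)\<^sup>2) \<le> (2 * I B) powr (1 + \<theta>)" for B
  proof -
    define u where "u = (\<lambda>x. h x - resamp n r B h x)"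
    have eq: "g x - resamp n r B g x = noise n r ((1 - \<alpha>) ^ m) u x" for x
      unfolding g_def u_def resamp_noise noise_diff ..
    have "mean n r (\<lambda>x. (noise n r ((1 - \<alpha>) ^ m) u x)\<^sup>2) \<le> mean n r (\<lambda>x. \<bar>u x\<bar>) powr (1 + 1 / 2 ^ Suc k)"
    proof (rule noise_square_le_powr[OF kap r rho(1)])
      show "((1 - \<alpha>) ^ m) ^ 2 ^ k \<le> \<kappa> / 2" using m by (simp add: power_mult)
      show "\<bar>u x\<bar> \<le> 1" for x
        unfolding u_def using h[of x] resamp_bounds[OF r01 h01, where n = n and B = B and x = x] by auto
    qed
    also have "mean n r (\<lambda>x. \<bar>u x\<bar>) = 2 * I B"
      unfolding u_def I_def by (rule L1_resamp_indicator[OF r01 h])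
    finally show ?thesis unfolding eq \<theta>_def .
  qed
  have gJ: "\<alpha> / 2 * mean n r (\<lambda>x. (g x - resamp n r (\<lambda>i. i \<notin> J) g x)\<^sup>2) \<le> 2 * C * \<alpha> * (2 * \<tau>) powr \<theta>"
  proof -
    have "\<alpha> / 2 * mean n r (\<lambda>x. (g x - resamp n r (\<lambda>i. i \<notin> J) g x)\<^sup>2) \<le>
       mean n \<alpha> (\<lambda>B. w B * mean n r (\<lambda>x. (g x - resamp n r B g x)\<^sup>2))"
    proof (rule resamp_variance_covering[OF r01 al'])
      \<comment> \<open>Influential sets use less than half of the mass \<open>\<alpha>\<close> of
        the sets containing \<open>i\<close>.\<close>
      fix i assume i: "i < n" "i \<notin> J"
      have "\<alpha> = mean n \<alpha> (\<lambda>B. of_bool (B i))" using i al' by (simp add: mean_coord)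
      also have "\<dots> = mean n \<alpha> (\<lambda>B. w B * of_bool (B i) + of_bool (\<tau> \<le> I B) * of_bool (B i))"
        unfolding w_def by (rule arg_cong[of _ _ "mean n \<alpha>"]) auto
      also have "\<dots> = mean n \<alpha> (\<lambda>B. w B * of_bool (B i)) + mean n \<alpha> (\<lambda>B. of_bool (\<tau> \<le> I B) * of_bool (B i))"
        by (rule mean_simps)
      finally show "\<alpha> / 2 \<le> mean n \<alpha> (\<lambda>B. w B * of_bool (B i))" using i by (auto simp: J_def)
    qed (simp add: w_def)
    also have "\<dots> \<le> mean n \<alpha> (\<lambda>B. (2 * (2 * \<tau>) powr \<theta>) * I B)"
    proof (rule mean_mono[OF al'])
      fix B
      show "w B * mean n r (\<lambda>x. (g x - resamp n r B g x)\<^sup>2) \<le> (2 * (2 * \<tau>) powr \<theta>) * I B"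
      proof (cases "I B < \<tau>")
        case True
        have "(2 * I B) powr (1 + \<theta>) = 2 * I B * (2 * I B) powr \<theta>"
          using I0[of B] by (cases "I B = 0") (auto simp: powr_add)
        also have "\<dots> \<le> 2 * I B * (2 * \<tau>) powr \<theta>"
          using True I0[of B] by (intro mult_left_mono powr_mono2) (auto simp: \<theta>_def)
        finally show ?thesis using gP[of B] True by (simp add: w_def mult_ac)
      next
        case False
        then show ?thesis using I0[of B] by (simp add: w_def)
      qed
    qed
    also have "\<dots> \<le> (2 * (2 * \<tau>) powr \<theta>) * (C * \<alpha>)"
      unfolding mean_simps using mean_I by (intro mult_left_mono) auto
    finally show ?thesis by (simp add: mult_ac)
  qed
  have gJ': "mean n r (\<lambda>x. (g x - resamp n r (\<lambda>i. i \<notin> J) g x)\<^sup>2) \<le> 4 * C * (2 * \<tau>) powr \<theta>"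
  proof -
    have "\<alpha> * (mean n r (\<lambda>x. (g x - resamp n r (\<lambda>i. i \<notin> J) g x)\<^sup>2)) \<le> \<alpha> * (4 * C * (2 * \<tau>) powr \<theta>)"
      using gJ by (simp add: algebra_simps)
    then show ?thesis using al by simp
  qed
  have hg: "mean n r (\<lambda>x. (h x - g x)\<^sup>2) \<le> 2 * real m * (C * \<alpha>)"
  proof -
    have sq: "(h x - g x)\<^sup>2 = 2 * (h x * (1 - g x)) + ((g x)\<^sup>2 - (h x)\<^sup>2)" for x
      using h[of x] by (auto simp: power2_eq_square algebra_simps)
    have "mean n r (\<lambda>x. (h x - g x)\<^sup>2) = 2 * mean n r (\<lambda>x. h x * (1 - g x)) +
       (mean n r (\<lambda>x. (g x)\<^sup>2) - mean n r (\<lambda>x. (h x)\<^sup>2))"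
      unfolding sq by (simp only: mean_simps)
    also have "\<dots> \<le> 2 * mean n r (\<lambda>x. h x * (1 - g x))"
      using mean_noise_contract[OF r01 rho, of n h] by (simp add: g_def)
    also have "mean n r (\<lambda>x. h x * (1 - g x)) \<le> real m * (C * \<alpha>)"
    proof -
      have z: "h x * (1 - h x) = 0" for x using h[of x] by auto
      have "mean n r (\<lambda>x. h x * (1 - g x)) \<le> real m * mean n r (\<lambda>x. h x * (1 - noise n r (1 - \<alpha>) h x))"
        using noise_sensitivity_power[OF r01 _ _ h01, where \<rho> = "1 - \<alpha>" and n = n and m = m] al
        by (simp add: g_def z mean_const r01)
      also have "\<dots> \<le> real m * (C * \<alpha>)" by (intro mult_left_mono stable) simp
      finally show ?thesis .
    qed
    finally show ?thesis by simp
  qed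
  have "mean n r (\<lambda>x. (h x - resamp n r (\<lambda>i. i \<notin> J) h x)\<^sup>2) \<le>
     mean n r (\<lambda>x. 2 * (h x - g x)\<^sup>2 + 2 * (g x - resamp n r (\<lambda>i. i \<notin> J) g x)\<^sup>2)"
  proof -
    define P where "P = resamp n r (\<lambda>i. i \<notin> J)"
    have sqle: "(a + b)\<^sup>2 \<le> 2 * a\<^sup>2 + 2 * b\<^sup>2" for a b :: real
      using zero_le_power2[of "a - b"] by (simp add: power2_eq_square algebra_simps)
    \<comment> \<open>Adding and subtracting \<open>g\<close>: the first summand is a projection of
      \<open>h - g\<close> and costs no more than its norm.\<close>
    have split: "h x - P h x = ((h x - g x) - P (\<lambda>x. h x - g x) x) + (g x - P g x)" for x
      unfolding P_def resamp_diff by simp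
    have "mean n r (\<lambda>x. (h x - P h x)\<^sup>2) \<le>
       mean n r (\<lambda>x. 2 * ((h x - g x) - P (\<lambda>x. h x - g x) x)\<^sup>2 + 2 * (g x - P g x)\<^sup>2)"
      unfolding split by (intro mean_mono r01 sqle)
    also have "\<dots> = 2 * mean n r (\<lambda>x. ((h x - g x) - P (\<lambda>x. h x - g x) x)\<^sup>2) + 2 * mean n r (\<lambda>x. (g x - P g x)\<^sup>2)"
      by (simp only: mean_simps)
    also have "mean n r (\<lambda>x. ((h x - g x) - P (\<lambda>x. h x - g x) x)\<^sup>2) \<le> mean n r (\<lambda>x. (h x - g x)\<^sup>2)"
      unfolding P_def mean_resamp_diff_square using mean_nonneg[OF r01, of "\<lambda>x. (resamp n r (\<lambda>i. i \<notin> J) (\<lambda>x. h x - g x) x)\<^sup>2" n]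
      by simp
    finally show ?thesis unfolding mean_simps P_def by simp
  qed
  also have "\<dots> = 2 * mean n r (\<lambda>x. (h x - g x)\<^sup>2) + 2 * mean n r (\<lambda>x. (g x - resamp n r (\<lambda>i. i \<notin> J) g x)\<^sup>2)"
    by (simp only: mean_simps)
  also have "\<dots> \<le> 4 * real m * (C * \<alpha>) + 8 * C * (2 * \<tau>) powr (1 / 2 ^ Suc k)"
    using hg gJ' by (simp add: \<theta>_def)
  finally show ?thesis using J cardJ by blast
qed

text \<open>The order of choices matters: \<open>k\<close>, \<open>\<tau>\<close> and
  \<open>l\<close> are fixed before \<open>\<alpha>\<close>, and only the number \<open>m\<close> of
  noise steps depends on it, with \<open>m * \<alpha>\<close> staying close to
  \<open>A / 2 ^ k\<close>.\<close>

lemma noise_stable_junta: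
  assumes kap: "0 < \<kappa>" "\<kappa> \<le> 1/2" and C: "0 < C" and eta: "0 < \<eta>"
  shows "\<exists>l \<alpha>0. 0 < \<alpha>0 \<and> (\<forall>n r \<alpha> h. \<kappa> \<le> r \<longrightarrow> r \<le> 1 - \<kappa> \<longrightarrow> 0 < \<alpha> \<longrightarrow> \<alpha> \<le> \<alpha>0 \<longrightarrow>
     (\<forall>x. h x = 0 \<or> h x = (1::real)) \<longrightarrow>
     mean n r (\<lambda>x. h x * (1 - noise n r (1 - \<alpha>) h x)) \<le> C * \<alpha> \<longrightarrow>
     (\<exists>J \<subseteq> {..<n}. card J \<le> l \<and> mean n r (\<lambda>x. (h x - resamp n r (\<lambda>i. i \<notin> J) h x)\<^sup>2) \<le> \<eta>))"
proof -
  \<comment> \<open>The heat-flow time after which the retention probability is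
    \<open>\<kappa> / 2\<close>.\<close>
  define A where "A = ln (2 / \<kappa>)"
  have A: "0 < A" unfolding A_def using kap by (intro ln_gt_zero) (simp add: field_simps)
  \<comment> \<open>Running the flow only for time \<open>A / 2 ^ k\<close> keeps the smoothing
    error small; the gain exponent drops to \<open>\<theta>\<close>, for which \<open>\<tau>\<close>
    compensates.\<close>
  obtain k :: nat where k: "16 * C * A / \<eta> < 2 ^ k"
    using real_arch_pow[of 2 "16 * C * A / \<eta>"] by auto
  define \<theta> :: real where "\<theta> = 1 / 2 ^ Suc k"
  have th: "0 < \<theta>" by (simp add: \<theta>_def)
  define \<tau> where "\<tau> = (\<eta> / (16 * C)) powr (1 / \<theta>) / 2"
  have tau: "0 < \<tau>" "(2 * \<tau>) powr \<theta> = \<eta> / (16 * C)"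
    using C eta th by (auto simp: \<tau>_def powr_powr)
  define l where "l = nat \<lfloor>4 * C / \<tau>\<rfloor> + 1"
  have l: "4 * C / \<tau> < real l" "0 < l" unfolding l_def using C tau by linarith+
  \<comment> \<open>The three bounds serve the range of \<open>\<alpha>\<close>, the pair count for
    popular coordinates, and the rounding of \<open>m\<close>.\<close>
  define \<alpha>0 where "\<alpha>0 = min (1/2) (min (1 / (4 * real l)) (\<eta> / (16 * C)))"
  have "\<exists>J \<subseteq> {..<n}. card J \<le> l \<and> mean n r (\<lambda>x. (h x - resamp n r (\<lambda>i. i \<notin> J) h x)\<^sup>2) \<le> \<eta>"
    if r: "\<kappa> \<le> r" "r \<le> 1 - \<kappa>" and al: "0 < \<alpha>" "\<alpha> \<le> \<alpha>0" and h: "\<forall>x. h x = 0 \<or> h x = (1::real)"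
      and st: "mean n r (\<lambda>x. h x * (1 - noise n r (1 - \<alpha>) h x)) \<le> C * \<alpha>" for n r \<alpha> h
  proof -
    have al1: "\<alpha> \<le> 1" "\<alpha> \<le> 1 / (4 * real l)" "\<alpha> \<le> \<eta> / (16 * C)" using al by (auto simp: \<alpha>0_def)
    define m where "m = nat \<lceil>A / (\<alpha> * 2 ^ k)\<rceil>"
    have m1: "A / (\<alpha> * 2 ^ k) \<le> real m" "real m \<le> A / (\<alpha> * 2 ^ k) + 1"
      using A al by (auto simp: m_def of_nat_ceiling)
    have "(1 - \<alpha>) ^ (m * 2 ^ k) \<le> exp (- \<alpha>) ^ (m * 2 ^ k)"
      using al al1 exp_ge_add_one_self[of "- \<alpha>"] by (intro power_mono) auto
    also have "\<dots> = exp (- (\<alpha> * 2 ^ k * real m))" by (simp add: exp_of_nat_mult[symmetric] mult_ac)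
    also have "\<dots> \<le> exp (- A)" using m1(1) al by (simp add: field_simps)
    also have "\<dots> = \<kappa> / 2" unfolding A_def using kap by (simp add: exp_minus)
    finally have m: "(1 - \<alpha>) ^ (m * 2 ^ k) \<le> \<kappa> / 2" .
    obtain J where J: "J \<subseteq> {..<n}" "card J \<le> l"
       "mean n r (\<lambda>x. (h x - resamp n r (\<lambda>i. i \<notin> J) h x)\<^sup>2) \<le>
          4 * real m * (C * \<alpha>) + 8 * C * (2 * \<tau>) powr (1 / 2 ^ Suc k)"
      using noise_stable_junta_step[OF kap r al(1) al1(1) _ st m tau(1) l(1) al1(2)] h by blast
    have "real m * \<alpha> \<le> (A / (\<alpha> * 2 ^ k) + 1) * \<alpha>" using m1 al by (intro mult_right_mono) auto
    also have "\<dots> = A / 2 ^ k + \<alpha>" using al by (simp add: field_simps)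
    also have "\<dots> \<le> \<eta> / (16 * C) + \<eta> / (16 * C)"
    proof (rule add_mono[OF _ al1(3)])
      show "A / 2 ^ k \<le> \<eta> / (16 * C)" using k C eta by (simp add: field_simps)
    qed
    finally have "4 * C * (real m * \<alpha>) \<le> 4 * C * (\<eta> / (16 * C) + \<eta> / (16 * C))"
      using C by (intro mult_left_mono) auto
    also have "\<dots> = \<eta> / 2" using C by (simp add: field_simps)
    finally have "4 * real m * (C * \<alpha>) \<le> \<eta> / 2" by (simp add: mult_ac)
    moreover have "8 * C * (2 * \<tau>) powr (1 / 2 ^ Suc k) = \<eta> / 2"
      using tau(2) C unfolding \<theta>_def by simp
    ultimately have "mean n r (\<lambda>x. (h x - resamp n r (\<lambda>i. i \<notin> J) h x)\<^sup>2) \<le> \<eta>"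
      using J(3) by linarith
    with J show ?thesis by blast
  qed
  moreover have "0 < \<alpha>0" using l C eta by (simp add: \<alpha>0_def)
  ultimately show ?thesis by blast
qed

section \<open>Passing between levels\<close>

text \<open>\<open>mean\<close> starts at the point that is \<open>False\<close> everywhere, so all
  points it visits lie in the cube.\<close>

lemma mean_mono_cube:
  "0 \<le> r \<Longrightarrow> r \<le> 1 \<Longrightarrow> (\<And>x. x \<in> cube n \<Longrightarrow> f x \<le> g x) \<Longrightarrow> mean n r f \<le> mean n r g"
  unfolding mean_def by (rule kop_mono_on[OF stoch_bern]) (auto simp: cube_def)

section \<open>Restrictions of coordinates\<close>

definition ovr :: "nat set \<Rightarrow> (nat \<Rightarrow> bool) \<Rightarrow> (nat \<Rightarrow> bool) \<Rightarrow> nat \<Rightarrow> bool" where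
  "ovr J a x = (\<lambda>i. if i \<in> J then a i else x i)"

text \<open>Restriction is absorbed into the kernel: the coordinates in \<open>J\<close> move to
  \<open>a\<close> deterministically.\<close>

lemma kop_ovr:
  "stoch n k \<Longrightarrow> J \<subseteq> {..<n} \<Longrightarrow>
   kop n k (\<lambda>y. f (ovr J a y)) x = kop n (\<lambda>i c b. if i \<in> J then of_bool (a i = b) else k i c b) f x"
proof (induction n arbitrary: f J)
  case 0
  then show ?case by (simp add: ovr_def)
next
  case (Suc n)
  have eq: "ovr J a (x(n := u)) = (ovr (J - {n}) a x)(n := if n \<in> J then a n else u)" for x u
    by (rule ext) (simp add: ovr_def)
  have "kop n k (\<lambda>y. g (ovr (J - {n}) a y)) x = kop n (\<lambda>i c b. if i \<in> J then of_bool (a i = b) else k i c b) g x" for g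
  proof -
    have "kop n k (\<lambda>y. g (ovr (J - {n}) a y)) x =
      kop n (\<lambda>i c b. if i \<in> J - {n} then of_bool (a i = b) else k i c b) g x"
      by (rule Suc.IH) (use Suc.prems stoch_SucD in \<open>auto simp: less_Suc_eq\<close>)
    also have "\<dots> = kop n (\<lambda>i c b. if i \<in> J then of_bool (a i = b) else k i c b) g x"
      by (rule kop_cong_kernel) auto
    finally show ?thesis .
  qed
  from this[of "\<lambda>y. f (y(n := True))"] this[of "\<lambda>y. f (y(n := False))"]
  show ?case using stoch_SucD(3)[OF Suc.prems(1), of "x n"]
    by (cases "n \<in> J"; cases "a n") (simp_all add: eq distrib_right[symmetric] del: fun_upd_apply)
qed

text \<open>Both sides fix \<open>J\<close> to \<open>b\<close> and refresh the rest. Membership of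
  \<open>b\<close> in the cube aligns the coordinates from \<open>n\<close> on, which resampling
  keeps and \<open>mean\<close> sets to \<open>False\<close>.\<close>

lemma resamp_eq_mean_ovr:
  assumes "0 \<le> r" "r \<le> 1" "J \<subseteq> {..<n}" "b \<in> cube n"
  shows "resamp n r (\<lambda>i. i \<notin> J) f b = mean n r (\<lambda>x. f (ovr J b x))"
  unfolding resamp_def mean_def kop_ovr[OF stoch_bern[OF assms(1,2)] assms(3)]
  by (rule kop_cong_point) (use assms(4) in \<open>auto simp: cube_def\<close>)

text \<open>The coupled pair shows the patterns \<open>a\<close> and \<open>b\<close> on
  \<open>J\<close> with probability at least \<open>c ^ card J\<close>, independently of the other
  coordinates. Thus a small violation probability remains small after restricting the two points
  differently.\<close>

lemma joint_restrict:
  assumes "stoch n (\<lambda>i _. m i)" "stoch n k" "J \<subseteq> {..<n}" "\<And>x. 0 \<le> F x" "\<And>x. 0 \<le> G x" "0 \<le> c"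
    and "\<And>i. i < n \<Longrightarrow> i \<in> J \<Longrightarrow> c \<le> m i (a i) * k i (a i) (b i)"
  shows "c ^ card J *
      kop n (\<lambda>i _. m i) (\<lambda>x. F (ovr J a x) * kop n k (\<lambda>y. G (ovr J b y)) x) x0 \<le>
    kop n (\<lambda>i _. m i) (\<lambda>x. F x * kop n k G x) x0"
  using assms
proof (induction n arbitrary: F G J)
  case 0
  then show ?case by (simp add: ovr_def)
next
  case (Suc n)
  define X where "X F G = kop n (\<lambda>i _. m i) (\<lambda>x. F x * kop n k G x) x0" for F G
  define J' where "J' = J - {n}"
  have st: "stoch n (\<lambda>i _. m i)" "stoch n k" using Suc.prems(1,2) stoch_SucD by auto
  note SucD = stoch_SucD[OF Suc.prems(1)] stoch_SucD[OF Suc.prems(2)]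
  have X0: "0 \<le> X F G" if "\<And>x. 0 \<le> F x" "\<And>x. 0 \<le> G x" for F G
    unfolding X_def using that by (intro kop_nonneg st mult_nonneg_nonneg)
  have full: "kop (Suc n) (\<lambda>i _. m i) (\<lambda>x. F x * kop (Suc n) k G x) x0 =
     m n True * k n True True * X (\<lambda>x. F (x(n := True))) (\<lambda>x. G (x(n := True))) +
     m n True * k n True False * X (\<lambda>x. F (x(n := True))) (\<lambda>x. G (x(n := False))) +
     m n False * k n False True * X (\<lambda>x. F (x(n := False))) (\<lambda>x. G (x(n := True))) +
     m n False * k n False False * X (\<lambda>x. F (x(n := False))) (\<lambda>x. G (x(n := False)))" for F G
    unfolding X_def
    by (simp add: kop_upd kop_add kop_cmult distrib_left mult.left_commute mult.assoc)
  have eq: "ovr J a (x(n := u)) = (ovr J' a x)(n := if n \<in> J then a n else u)" for a x u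
    by (rule ext) (simp add: ovr_def J'_def)
  have IH: "c ^ card J' * X (\<lambda>x. F (ovr J' a x)) (\<lambda>y. G (ovr J' b y)) \<le> X F G"
    if "\<And>x. 0 \<le> F x" "\<And>x. 0 \<le> G x" for F G
    unfolding X_def
  proof (rule Suc.IH[where F = F and G = G and J = J'])
    show "J' \<subseteq> {..<n}" using Suc.prems(3) by (auto simp: J'_def less_Suc_eq)
    show "c \<le> m i (a i) * k i (a i) (b i)" if "i < n" "i \<in> J'" for i
      using Suc.prems(7)[of i] that by (simp add: J'_def)
  qed (use st that Suc.prems(6) in auto)
  show ?case
  proof (cases "n \<in> J")
    case False
    then have J': "J' = J" by (simp add: J'_def)
    have IH': "c ^ card J * X (\<lambda>x. F ((ovr J a x)(n := u))) (\<lambda>y. G ((ovr J b y)(n := v))) \<le>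
       X (\<lambda>x. F (x(n := u))) (\<lambda>x. G (x(n := v)))" for u v
      using IH[of "\<lambda>x. F (x(n := u))" "\<lambda>x. G (x(n := v))"] Suc.prems(4,5) unfolding J' by simp
    have step: "c ^ card J * (m n u * k n u v * X (\<lambda>x. F ((ovr J a x)(n := u))) (\<lambda>y. G ((ovr J b y)(n := v)))) \<le>
       m n u * k n u v * X (\<lambda>x. F (x(n := u))) (\<lambda>x. G (x(n := v)))" for u v
      using mult_left_mono[OF IH'[of u v], of "m n u * k n u v"] SucD by (simp add: mult_ac)
    show ?thesis unfolding full eq J' using False
      by (simp only: if_False distrib_left) (intro add_mono step)
  next
    case True
    define Y where "Y = X (\<lambda>x. F ((ovr J' a x)(n := a n))) (\<lambda>y. G ((ovr J' b y)(n := b n)))"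
    have "finite J" using Suc.prems(3) finite_subset by blast
    then have card: "card J = Suc (card J')" unfolding J'_def by (rule card.remove[OF _ True])
    \<comment> \<open>The restricted functions ignore coordinate \<open>n\<close>, so the four pair
      weights sum to one.\<close>
    have "kop (Suc n) (\<lambda>i _. m i) (\<lambda>x. F (ovr J a x) * kop (Suc n) k (\<lambda>y. G (ovr J b y)) x) x0 =
       (m n True * (k n True True + k n True False) + m n False * (k n False True + k n False False)) * Y"
      unfolding full eq Y_def using True by (simp add: algebra_simps)
    also have "\<dots> = Y" using SucD by simp
    finally have "c ^ card J * kop (Suc n) (\<lambda>i _. m i) (\<lambda>x. F (ovr J a x) * kop (Suc n) k (\<lambda>y. G (ovr J b y)) x) x0
      = c * (c ^ card J' * Y)" by (simp add: card)
    also have "\<dots> \<le> c * X (\<lambda>x. F (x(n := a n))) (\<lambda>x. G (x(n := b n)))"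
      unfolding Y_def
      by (rule mult_left_mono[OF IH[of "\<lambda>x. F (x(n := a n))" "\<lambda>x. G (x(n := b n))"] Suc.prems(6)])
        (rule Suc.prems(4,5))+
    also have "\<dots> \<le> m n (a n) * k n (a n) (b n) * X (\<lambda>x. F (x(n := a n))) (\<lambda>x. G (x(n := b n)))"
      using Suc.prems(7)[of n] True Suc.prems(4,5) by (intro mult_right_mono X0) auto
    \<comment> \<open>Of the four nonnegative terms only the one with last bits \<open>a n\<close>
      and \<open>b n\<close> is kept.\<close>
    also have "\<dots> \<le> kop (Suc n) (\<lambda>i _. m i) (\<lambda>x. F x * kop (Suc n) k G x) x0"
    proof -
      have nn: "0 \<le> m n u * k n u v * X (\<lambda>x. F (x(n := u))) (\<lambda>x. G (x(n := v)))" for u v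
        using SucD Suc.prems(4,5) by (intro mult_nonneg_nonneg X0) auto
      show ?thesis unfolding full
        using nn[of True True] nn[of True False] nn[of False True] nn[of False False]
        by (cases "a n"; cases "b n") (simp_all del: fun_upd_apply)
    qed
    finally show ?thesis .
  qed
qed

text \<open>Conditional expectation of a function of the upper point given the lower point in the
  monotone coupling: ones stay, zeros flip with probability
  \<open>(p - q) / (1 - q)\<close>.\<close>

definition up :: "nat \<Rightarrow> real \<Rightarrow> real \<Rightarrow> ((nat \<Rightarrow> bool) \<Rightarrow> real) \<Rightarrow> (nat \<Rightarrow> bool) \<Rightarrow> real" where
  "up n q p = kop n (\<lambda>_ a b. if a then of_bool b else bern ((p - q) / (1 - q)) b)"

text \<open>The reverse conditional expectation, given the upper point: zeros stay and ones survive
  with probability \<open>q / p\<close>.\<close>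

definition dn :: "nat \<Rightarrow> real \<Rightarrow> real \<Rightarrow> ((nat \<Rightarrow> bool) \<Rightarrow> real) \<Rightarrow> (nat \<Rightarrow> bool) \<Rightarrow> real" where
  "dn n p q = kop n (\<lambda>_ a b. if a then bern (q / p) b else of_bool (\<not> b))"

lemma stoch_up: "0 < q \<Longrightarrow> q \<le> p \<Longrightarrow> p < 1 \<Longrightarrow> stoch n (\<lambda>_ a b. if a then of_bool b else bern ((p - q) / (1 - q)) b)"
  by (rule stochI) (auto simp: bern_def)

lemma stoch_dn: "0 < q \<Longrightarrow> q \<le> p \<Longrightarrow> p < 1 \<Longrightarrow> stoch n (\<lambda>_ a b. if a then bern (q / p) b else of_bool (\<not> b))"
  by (rule stochI) (auto simp: bern_def)

lemma up_dn_adjoint: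
  "0 < q \<Longrightarrow> q \<le> p \<Longrightarrow> p < 1 \<Longrightarrow> mean n q (\<lambda>x. F x * up n q p G x) = mean n p (\<lambda>x. dn n p q F x * G x)"
  unfolding mean_def up_def dn_def by (rule kop_adjoint) (auto simp: bern_def field_simps split: if_splits)

lemma dn_dn:
  "0 < q \<Longrightarrow> q \<le> s \<Longrightarrow> s \<le> p \<Longrightarrow> p < 1 \<Longrightarrow> dn n p s (dn n s q F) = dn n p q F"
  unfolding dn_def kop_comp by (intro ext kop_cong_kernel) (auto simp: bern_def field_simps)

text \<open>The two-step kernel is reversible for bias \<open>s\<close>, hence a noise kernel. Its
  rate is found by matching the flip probabilities: \<open>\<alpha> * (1 - s) = 1 - s / t\<close>
  from one to zero and \<open>\<alpha> * s\<close> from zero to one.\<close>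

lemma up_dn:
  assumes "0 < s" "s \<le> t" "t < 1"
  shows "up n s t (dn n t s F) = noise n s (1 - (t - s) / ((1 - s) * t)) F"
proof -
  define \<alpha> where "\<alpha> = (t - s) / ((1 - s) * t)"
  have t: "0 < t" "0 < 1 - s" using assms by auto
  have 1: "\<alpha> * (1 - s) = 1 - s / t" unfolding \<alpha>_def using t by (simp add: field_simps)
  have 2: "(t - s) / (1 - s) * (s / t) = \<alpha> * s" unfolding \<alpha>_def using t by (simp add: field_simps)
  show ?thesis
    unfolding dn_def up_def noise_def kop_comp \<alpha>_def[symmetric]
  proof (intro ext kop_cong_kernel)
    fix a b
    show "(if a then of_bool True else bern ((t - s) / (1 - s)) True) * (if True then bern (s / t) b else of_bool (\<not> b)) +
       (if a then of_bool False else bern ((t - s) / (1 - s)) False) * (if False then bern (s / t) b else of_bool (\<not> b)) =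
       (1 - \<alpha>) * of_bool (a = b) + (1 - (1 - \<alpha>)) * bern s b"
      using 1 2 by (cases a; cases b) (simp_all add: right_diff_distrib)
  qed
qed

lemma up_const: "0 < q \<Longrightarrow> q \<le> p \<Longrightarrow> p < 1 \<Longrightarrow> up n q p (\<lambda>_. c) x = c"
  unfolding up_def by (rule kop_const[OF stoch_up])

lemma dn_const: "0 < q \<Longrightarrow> q \<le> p \<Longrightarrow> p < 1 \<Longrightarrow> dn n p q (\<lambda>_. c) x = c"
  unfolding dn_def by (rule kop_const[OF stoch_dn])

lemma mean_up: "0 < q \<Longrightarrow> q \<le> p \<Longrightarrow> p < 1 \<Longrightarrow> mean n q (up n q p G) = mean n p G"
  using up_dn_adjoint[of q p n "\<lambda>_. 1" G] by (simp add: dn_const)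

lemma mean_dn: "0 < q \<Longrightarrow> q \<le> p \<Longrightarrow> p < 1 \<Longrightarrow> mean n p (dn n p q F) = mean n q F"
  using up_dn_adjoint[of q p n F "\<lambda>_. 1"] by (simp add: up_const)

lemma up_bounds:
  assumes "0 < q" "q \<le> p" "p < 1" "\<And>x. 0 \<le> f x" "\<And>x. f x \<le> 1"
  shows "0 \<le> up n q p f x" "up n q p f x \<le> 1"
  using assms unfolding up_def by (auto intro!: kop_nonneg kop_le_const stoch_up)

lemma dn_bounds:
  assumes "0 < q" "q \<le> p" "p < 1" "\<And>x. 0 \<le> f x" "\<And>x. f x \<le> 1"
  shows "0 \<le> dn n p q f x" "dn n p q f x \<le> 1"
  using assms unfolding dn_def by (auto intro!: kop_nonneg kop_le_const stoch_dn)

text \<open>By \<open>up_dn\<close> and adjointness the sensitivity of \<open>h\<close> is the mean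
  of \<open>G - G\<^sup>2\<close> at level \<open>t\<close>, where \<open>G\<close> is
  \<open>h\<close> brought to that level. If \<open>G\<close> is nearly dominated by a function of
  almost the same mean, then \<open>G\<close> is nearly Boolean.\<close>

lemma noise_sensitivity_of_chain:
  assumes st: "0 < s" "s \<le> t" "t < 1"
    and h: "\<And>x. 0 \<le> h x" "\<And>x. h x \<le> 1" and h': "\<And>x. 0 \<le> h' x" "\<And>x. h' x \<le> 1"
    and chain: "mean n t (\<lambda>x. (1 - h' x) * dn n t s h x) \<le> \<beta>"
  shows "mean n s (\<lambda>x. h x * (1 - noise n s (1 - (t - s) / ((1 - s) * t)) h x)) \<le>
     mean n t h' - mean n s h + 2 * \<beta>"
proof -
  have t01: "0 \<le> t" "t \<le> 1" using st by auto
  define G where "G = dn n t s h"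
  have G: "0 \<le> G x" "G x \<le> 1" for x unfolding G_def using dn_bounds[OF st h] by auto
  have mG: "mean n t G = mean n s h" unfolding G_def by (rule mean_dn[OF st])
  have "mean n s (\<lambda>x. h x * (1 - noise n s (1 - (t - s) / ((1 - s) * t)) h x)) =
     mean n s (\<lambda>x. h x - h x * up n s t G x)"
    unfolding up_dn[OF st, symmetric] G_def by (simp add: right_diff_distrib)
  also have "\<dots> = mean n s h - mean n s (\<lambda>x. h x * up n s t G x)" by (simp only: mean_simps)
  also have "mean n s (\<lambda>x. h x * up n s t G x) = mean n t (\<lambda>x. G x * G x)"
    unfolding up_dn_adjoint[OF st] G_def ..
  also have "mean n s h - mean n t (\<lambda>x. G x * G x) = mean n t (\<lambda>x. G x - G x * G x)"
    unfolding mG[symmetric] mean_simps ..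
  also have "\<dots> \<le> mean n t (\<lambda>x. (h' x - G x) + 2 * ((1 - h' x) * G x))"
  proof (rule mean_mono[OF t01])
    fix x
    \<comment> \<open>This is the expected squared distance of \<open>G x\<close> from a bit of bias
      \<open>h' x\<close>; expanding it gives the pointwise bound.\<close>
    have "0 \<le> h' x * (1 - G x) * (1 - G x) + (1 - h' x) * G x * G x"
      using G[of x] h'[of x] h'(2)[of x] by (intro add_nonneg_nonneg mult_nonneg_nonneg) auto
    then show "G x - G x * G x \<le> (h' x - G x) + 2 * ((1 - h' x) * G x)"
      by (simp add: algebra_simps)
  qed
  also have "\<dots> = (mean n t h' - mean n t G) + 2 * mean n t (\<lambda>x. (1 - h' x) * G x)"
    by (simp only: mean_simps)
  also have "\<dots> \<le> mean n t h' - mean n s h + 2 * \<beta>" using chain mG unfolding G_def by linarith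
  finally show ?thesis .
qed

lemma small_increment:
  fixes a :: "nat \<Rightarrow> real"
  assumes "\<And>i. 0 \<le> a i" "\<And>i. a i \<le> 1" "0 < M"
  shows "\<exists>m<M. a (Suc m) - a m \<le> 1 / real M"
proof (rule ccontr)
  assume "\<not> ?thesis"
  then have *: "1 / real M < a (Suc m) - a m" if "m < M" for m using that by force
  have "(\<Sum>m<M. 1 / real M) < (\<Sum>m<M. a (Suc m) - a m)"
    by (rule sum_strict_mono) (use * assms in auto)
  also have "\<dots> = a M - a 0" by (rule sum_lessThan_telescope)
  finally show False using assms(1)[of 0] assms(2)[of M] assms(3) by simp
qed

section \<open>Sharp thresholds after restriction\<close>

text \<open>Thresholding the expectations of \<open>f0\<close> at heights falling by a factor
  \<open>\<beta>\<close> per level makes consecutive Boolean functions nearly monotone. Their means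
  lie between 0 and 1, so some step grows by at most \<open>1 / M\<close>, and there
  \<open>noise_sensitivity_of_chain\<close> applies.\<close>

lemma sharp_threshold_level:
  fixes f0 f1 :: "(nat \<Rightarrow> bool) \<Rightarrow> real"
  assumes q: "0 < q" "q < p" "p < 1" and M: "0 < (M::nat)" and \<eta>0: "0 < \<eta>0"
    and f0: "\<And>x. 0 \<le> f0 x" "\<And>x. f0 x \<le> 1" and f1: "\<And>x. 0 \<le> f1 x" "\<And>x. f1 x \<le> 1"
    and viol: "mean n q (\<lambda>x. f0 x * up n q p (\<lambda>y. 1 - f1 y) x) \<le> \<eta>0 * (1 / (2 * real M)) ^ M * d"
    and d: "0 \<le> d"
  shows "\<exists>s t h. q + (p - q) / 2 \<le> s \<and> t \<le> p \<and> t - s = (p - q) / (2 * real M) \<and>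
    (\<forall>x. h x = 0 \<or> h x = (1::real)) \<and>
    mean n q (\<lambda>x. f0 x * up n q s (\<lambda>y. 1 - h y) x) \<le> \<eta>0 \<and>
    mean n s h \<le> mean n p f1 + d \<and>
    mean n s (\<lambda>x. h x * (1 - noise n s (1 - (t - s) / ((1 - s) * t)) h x)) \<le> 2 / real M"
proof -
  define \<beta> where "\<beta> = 1 / (2 * real M)"
  have be: "0 < \<beta>" "\<beta> \<le> 1" using M by (auto simp: \<beta>_def field_simps)
  define \<eta> where "\<eta> m = \<eta>0 * \<beta> ^ m" for m :: nat
  have eta_pos: "0 < \<eta> m" for m using be \<eta>0 by (simp add: \<eta>_def)
  have eta_le: "\<eta> m \<le> \<eta>0" for m
    using be \<eta>0 power_le_one[of \<beta> m] by (simp add: \<eta>_def)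
  \<comment> \<open>The levels fill only the upper half of the interval, so each stays at distance
    at least \<open>(p - q) / 2\<close> from \<open>q\<close>.\<close>
  define lev where "lev m = q + (p - q) * (1 + real m / real M) / 2" for m :: nat
  have lev_lo: "q + (p - q) / 2 \<le> lev m" for m
  proof -
    have "(p - q) * 1 \<le> (p - q) * (1 + real m / real M)" using q by (intro mult_left_mono) auto
    then show ?thesis unfolding lev_def by (intro add_left_mono divide_right_mono) simp_all
  qed
  have lev_le: "lev m \<le> p" if "m \<le> M" for m
  proof -
    have "real m / real M \<le> 1" using that M by simp
    then have "(p - q) * (1 + real m / real M) \<le> (p - q) * 2" using q by (intro mult_left_mono) auto
    then have "(p - q) * (1 + real m / real M) / 2 \<le> (p - q) * 2 / 2"
      by (rule divide_right_mono) simp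
    also have "\<dots> = p - q" by simp
    finally show ?thesis unfolding lev_def le_diff_eq by (simp only: add.commute)
  qed
  have lev_step: "lev (Suc m) - lev m = (p - q) / (2 * real M)" for m
    using M by (simp add: lev_def field_simps)
  have lev_q: "q \<le> lev m" for m using lev_lo[of m] q by (simp add: field_simps)
  define A where "A m = dn n (lev m) q f0" for m
  define h where "h m x = (of_bool (\<eta> m < A m x) :: real)" for m x
  have h01: "0 \<le> h m x" "h m x \<le> 1" for m x by (auto simp: h_def)
  have A0: "0 \<le> A m x" if "m \<le> M" for m x
    unfolding A_def using dn_bounds[OF _ _ _ f0] q lev_q[of m] lev_le[OF that] by auto
  have below: "mean n q (\<lambda>x. f0 x * up n q (lev m) (\<lambda>y. 1 - h m y) x) \<le> \<eta>0" if m: "m \<le> M" for m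
  proof -
    have "mean n q (\<lambda>x. f0 x * up n q (lev m) (\<lambda>y. 1 - h m y) x) = mean n (lev m) (\<lambda>x. A m x * (1 - h m x))"
      unfolding A_def using q lev_q[of m] lev_le[OF m] by (intro up_dn_adjoint) auto
    also have "\<dots> \<le> \<eta> m"
      using q lev_q[of m] lev_le[OF m] eta_pos[of m] by (intro mean_le_const) (auto simp: h_def)
    finally show ?thesis using eta_le[of m] by simp
  qed
  have above: "mean n (lev m) (h m) \<le> mean n p f1 + d" if m: "m \<le> M" for m
  proof -
    define s where "s = lev m"
    have s: "0 < s" "s \<le> p" "q \<le> s" "s < 1" "0 \<le> s" "s \<le> 1"
      using q lev_q[of m] lev_le[OF m] by (auto simp: s_def)
    have u1: "up n s p f1 x + up n s p (\<lambda>y. 1 - f1 y) x = 1" for x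
      unfolding up_def kop_diff using kop_const[OF stoch_up, of s p n 1 x] s q by simp
    have f1': "0 \<le> 1 - f1 x" "1 - f1 x \<le> 1" for x using f1[of x] by auto
    have ub: "0 \<le> up n s p f1 x" and ub': "0 \<le> up n s p (\<lambda>y. 1 - f1 y) x" for x
      by (rule up_bounds[OF s(1,2) q(3)], rule f1 f1', rule f1 f1')+
    \<comment> \<open>Where \<open>h m\<close> is 1, \<open>A m\<close> exceeds
      \<open>\<eta> m\<close>, so violations of \<open>h m\<close> against \<open>f1\<close> are at
      most violations of \<open>f0\<close> against \<open>f1\<close> divided by
      \<open>\<eta> m\<close>.\<close>
    have "\<eta> m * mean n s (\<lambda>x. h m x * up n s p (\<lambda>y. 1 - f1 y) x) =
       mean n s (\<lambda>x. \<eta> m * (h m x * up n s p (\<lambda>y. 1 - f1 y) x))" by (rule mean_simps(3)[symmetric])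
    also have "\<dots> \<le> mean n s (\<lambda>x. A m x * up n s p (\<lambda>y. 1 - f1 y) x)"
      using ub' A0[OF m] by (intro mean_mono s(5,6)) (auto simp: h_def intro!: mult_right_mono)
    also have "\<dots> = mean n p (\<lambda>x. dn n p s (A m) x * (1 - f1 x))"
      using s q by (intro up_dn_adjoint) auto
    also have "dn n p s (A m) = dn n p q f0"
      unfolding A_def s_def[symmetric] using s q by (intro dn_dn) auto
    also have "mean n p (\<lambda>x. dn n p q f0 x * (1 - f1 x)) = mean n q (\<lambda>x. f0 x * up n q p (\<lambda>y. 1 - f1 y) x)"
      using q by (intro up_dn_adjoint[symmetric]) auto
    also have "\<dots> \<le> \<eta>0 * \<beta> ^ M * d" using viol by (simp add: \<beta>_def)
    also have "\<dots> \<le> \<eta>0 * \<beta> ^ m * d"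
      using be \<eta>0 d m by (intro mult_right_mono mult_left_mono power_decreasing) auto
    finally have 1: "mean n s (\<lambda>x. h m x * up n s p (\<lambda>y. 1 - f1 y) x) \<le> d"
      using eta_pos[of m] by (simp add: \<eta>_def[symmetric])
    have "mean n s (h m) = mean n s (\<lambda>x. h m x * up n s p f1 x + h m x * up n s p (\<lambda>y. 1 - f1 y) x)"
      unfolding distrib_left[symmetric] u1 by simp
    also have "\<dots> = mean n s (\<lambda>x. h m x * up n s p f1 x) + mean n s (\<lambda>x. h m x * up n s p (\<lambda>y. 1 - f1 y) x)"
      by (rule mean_simps)
    also have "mean n s (\<lambda>x. h m x * up n s p f1 x) \<le> mean n s (up n s p f1)"
      using ub h01 by (intro mean_mono s(5,6) mult_left_le_one_le) auto
    also have "mean n s (up n s p f1) = mean n p f1" using s q by (intro mean_up) auto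
    finally show ?thesis using 1 by (simp add: s_def)
  qed
  \<comment> \<open>Clamping at \<open>M\<close> extends the sequence to all indices while keeping
    it in the unit interval.\<close>
  define a where "a m = mean n (lev (min m M)) (h (min m M))" for m
  have lev01: "0 \<le> lev m" "lev m \<le> 1" if "m \<le> M" for m
    using q lev_q[of m] lev_le[OF that] by auto
  have "\<exists>m<M. a (Suc m) - a m \<le> 1 / real M"
  proof (rule small_increment[OF _ _ M])
    fix i
    have i: "min i M \<le> M" by simp
    show "0 \<le> a i" unfolding a_def by (rule mean_nonneg[OF lev01[OF i] h01(1)])
    show "a i \<le> 1" unfolding a_def by (rule mean_le_const[OF lev01[OF i] h01(2)])
  qed
  then obtain m where m: "m < M" "a (Suc m) - a m \<le> 1 / real M" by blast
  have s: "0 < lev m" "lev m \<le> lev (Suc m)" "lev (Suc m) < 1" "lev (Suc m) \<le> p" "q \<le> lev m"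
  proof -
    have "0 \<le> (p - q) / (2 * real M)" using q by simp
    then show "lev m \<le> lev (Suc m)" using lev_step[of m] by linarith
    show "lev (Suc m) \<le> p" using lev_le[of "Suc m"] m by simp
    then show "lev (Suc m) < 1" using q by simp
    show "q \<le> lev m" by (rule lev_q)
    then show "0 < lev m" using q by simp
  qed
  have "mean n (lev (Suc m)) (\<lambda>x. (1 - h (Suc m) x) * dn n (lev (Suc m)) (lev m) (h m) x) \<le> \<beta>"
  proof (rule mean_le_const)
    fix x
    show "(1 - h (Suc m) x) * dn n (lev (Suc m)) (lev m) (h m) x \<le> \<beta>"
    proof (cases "\<eta> (Suc m) < A (Suc m) x")
      case True
      then show ?thesis using be by (simp add: h_def)
    next
      case False
      \<comment> \<open>Markov's inequality: \<open>A (Suc m) x\<close> is at most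
        \<open>\<eta> (Suc m)\<close>, which is \<open>\<beta>\<close> times the threshold defining
        \<open>h m\<close>.\<close>
      have "\<eta> m * dn n (lev (Suc m)) (lev m) (h m) x = dn n (lev (Suc m)) (lev m) (\<lambda>y. \<eta> m * h m y) x"
        unfolding dn_def by (rule kop_cmult[symmetric])
      also have "\<dots> \<le> dn n (lev (Suc m)) (lev m) (A m) x"
        unfolding dn_def using s A0[of m] m by (intro kop_mono stoch_dn) (auto simp: h_def)
      also have "\<dots> = A (Suc m) x" unfolding A_def using s q by (subst dn_dn) auto
      also have "\<dots> \<le> \<eta> m * \<beta>" using False by (simp add: \<eta>_def mult_ac)
      finally show ?thesis using False eta_pos[of m] by (simp add: h_def)
    qed
  qed (use s in auto)
  from noise_sensitivity_of_chain[where h = "h m" and h' = "h (Suc m)", OF s(1-3) h01 h01 this]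
  have "mean n (lev m) (\<lambda>x. h m x * (1 - noise n (lev m) (1 - (lev (Suc m) - lev m) / ((1 - lev m) * lev (Suc m))) (h m) x))
    \<le> mean n (lev (Suc m)) (h (Suc m)) - mean n (lev m) (h m) + 2 * \<beta>" .
  also have "\<dots> \<le> 2 / real M"
  proof -
    have "min (Suc m) M = Suc m" "min m M = m" using m by auto
    with m(2) have "mean n (lev (Suc m)) (h (Suc m)) - mean n (lev m) (h m) \<le> 1 / real M"
      by (simp only: a_def)
    moreover have "2 * \<beta> = 1 / real M" by (simp add: \<beta>_def)
    ultimately show ?thesis by simp
  qed
  finally have sens: "mean n (lev m) (\<lambda>x. h m x * (1 - noise n (lev m) (1 - (lev (Suc m) - lev m) / ((1 - lev m) * lev (Suc m))) (h m) x))
    \<le> 2 / real M" .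
  have "m \<le> M" using m by simp
  show ?thesis
  proof (rule exI[of _ "lev m"], rule exI[of _ "lev (Suc m)"], rule exI[of _ "h m"], intro conjI allI)
    show "h m x = 0 \<or> h m x = 1" for x by (simp add: h_def)
  qed (rule lev_lo s(4) lev_step below[OF \<open>m \<le> M\<close>] above[OF \<open>m \<le> M\<close>] sens)+
qed

text \<open>For Boolean \<open>h\<close> with projection \<open>H\<close>, the squared distance is
  the mean of \<open>H * (1 - H)\<close>. If \<open>H\<close> exceeded \<open>z\<close> on the whole
  cube, this would be at least \<open>z * (1 - mean n r h)\<close>.\<close>

lemma exists_low_restriction:
  assumes r: "0 \<le> r" "r \<le> 1" and h: "\<And>x. h x = 0 \<or> h x = (1::real)"
    and close: "mean n r (\<lambda>x. (h x - resamp n r (\<lambda>i. i \<notin> J) h x)\<^sup>2) < z * (1 - mean n r h)"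
  shows "\<exists>b\<in>cube n. resamp n r (\<lambda>i. i \<notin> J) h b \<le> z"
proof (rule ccontr)
  assume "\<not> ?thesis"
  then have no: "z < resamp n r (\<lambda>i. i \<notin> J) h b" if "b \<in> cube n" for b using that by force
  define H where "H = resamp n r (\<lambda>i. i \<notin> J) h"
  have h01: "0 \<le> h x" "h x \<le> 1" for x using h[of x] by auto
  have H01: "0 \<le> H x" "H x \<le> 1" for x unfolding H_def using resamp_bounds[OF r h01] by auto
  have h2: "(h x)\<^sup>2 = h x" for x using h[of x] by auto
  have "z * (1 - mean n r h) = mean n r (\<lambda>x. z * (1 - H x))"
    unfolding mean_simps mean_const[OF r] by (simp add: H_def mean_resamp)
  also have "\<dots> \<le> mean n r (\<lambda>x. H x * (1 - H x))"
  proof (rule mean_mono_cube[OF r])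
    fix x assume "x \<in> cube n"
    then show "z * (1 - H x) \<le> H x * (1 - H x)"
      using no[of x] H01[of x] by (intro mult_right_mono) (auto simp: H_def)
  qed
  also have "\<dots> = mean n r H - mean n r (\<lambda>x. (H x)\<^sup>2)"
    unfolding mean_simps[symmetric] by (simp add: power2_eq_square algebra_simps)
  also have "\<dots> = mean n r (\<lambda>x. (h x - H x)\<^sup>2)"
    unfolding H_def mean_resamp_diff_square by (simp add: h2 mean_resamp)
  finally show False using close by (simp add: H_def)
qed

text \<open>At an intermediate level \<open>f0\<close> is nearly dominated by a near-junta
  \<open>h\<close> whose mean is not close to 1, so some pattern \<open>b\<close> on the junta makes
  \<open>h\<close> small. The zero pattern lies below every \<open>b\<close>, so the coupling
  transfers smallness to \<open>f0\<close> with these coordinates set to 0. Two functions are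
  allowed because they will be restrictions of \<open>f\<close> to different patterns.\<close>

lemma sharp_threshold_restriction:
  fixes \<epsilon> e :: real
  assumes eps: "0 < \<epsilon>" "\<epsilon> \<le> 1/2" and e: "0 < e"
  shows "\<exists>l \<delta>. 0 < \<delta> \<and> (\<forall>n p q f0 f1. \<epsilon> \<le> q \<longrightarrow> p \<le> 1 - \<epsilon> \<longrightarrow> \<epsilon> \<le> p - q \<longrightarrow>
     (\<forall>x. 0 \<le> f0 x \<and> f0 x \<le> 1) \<longrightarrow> (\<forall>x. 0 \<le> f1 x \<and> f1 x \<le> 1) \<longrightarrow>
     mean n q (\<lambda>x. f0 x * up n q p (\<lambda>y. 1 - f1 y) x) \<le> \<delta> \<longrightarrow> mean n p f1 \<le> 1 - e \<longrightarrow>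
     (\<exists>J \<subseteq> {..<n}. card J \<le> l \<and> mean n q (\<lambda>x. f0 (ovr J (\<lambda>_. False) x)) \<le> e / 2))"
proof -
  \<comment> \<open>The noise rate is at least \<open>\<epsilon> / (2 * real M)\<close>, so this
    \<open>C\<close> turns the sensitivity bound \<open>2 / M\<close> into
    \<open>C * \<alpha>\<close>.\<close>
  define C where "C = 4 / \<epsilon>"
  have C: "0 < C" using eps by (simp add: C_def)
  \<comment> \<open>Strictly below \<open>e / 4 * (e / 2)\<close>, as
    \<open>exists_low_restriction\<close> requires.\<close>
  define \<eta> where "\<eta> = e\<^sup>2 / 16"
  have eta: "0 < \<eta>" using e by (simp add: \<eta>_def)
  from noise_stable_junta[OF eps C eta]
  obtain l \<alpha>0 where \<alpha>0: "0 < \<alpha>0" and junta: "\<forall>n r \<alpha> h. \<epsilon> \<le> r \<longrightarrow> r \<le> 1 - \<epsilon> \<longrightarrow> 0 < \<alpha> \<longrightarrow> \<alpha> \<le> \<alpha>0 \<longrightarrow>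
     (\<forall>x. h x = 0 \<or> h x = (1::real)) \<longrightarrow>
     mean n r (\<lambda>x. h x * (1 - noise n r (1 - \<alpha>) h x)) \<le> C * \<alpha> \<longrightarrow>
     (\<exists>J \<subseteq> {..<n}. card J \<le> l \<and> mean n r (\<lambda>x. (h x - resamp n r (\<lambda>i. i \<notin> J) h x)\<^sup>2) \<le> \<eta>)"
    by (elim exE conjE) (rule that)
  define M where "M = nat \<lceil>1 / (2 * \<epsilon>\<^sup>2 * \<alpha>0)\<rceil> + 1"
  have M: "0 < M" "1 / (2 * \<epsilon>\<^sup>2 * \<alpha>0) \<le> real M"
    unfolding M_def using real_nat_ceiling_ge[of "1 / (2 * \<epsilon>\<^sup>2 * \<alpha>0)"] by linarith+
  \<comment> \<open>A lower bound for the probabilities \<open>s - q\<close> and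
    \<open>1 - s\<close> of the pairs with lower bit 0; the first uses that \<open>s\<close> is in
    the upper half.\<close>
  define c where "c = \<epsilon> / 2"
  have c: "0 < c" "c \<le> 1" using eps by (auto simp: c_def)
  \<comment> \<open>The factor \<open>c ^ l\<close> pays for conditioning on the patterns on the
    junta.\<close>
  define \<eta>0 where "\<eta>0 = e / 4 * c ^ l"
  have \<eta>0: "0 < \<eta>0" using e c by (simp add: \<eta>0_def)
  define \<delta> where "\<delta> = \<eta>0 * (1 / (2 * real M)) ^ M * (e / 2)"
  show ?thesis
  proof (rule exI[of _ l], rule exI[of _ \<delta>], intro conjI allI impI)
    show "0 < \<delta>" using \<eta>0 M e by (simp add: \<delta>_def)
  next
    fix n p q and f0 f1 :: "(nat \<Rightarrow> bool) \<Rightarrow> real"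
    assume pq: "\<epsilon> \<le> q" "p \<le> 1 - \<epsilon>" "\<epsilon> \<le> p - q"
      and f0': "\<forall>x. 0 \<le> f0 x \<and> f0 x \<le> 1" and f1': "\<forall>x. 0 \<le> f1 x \<and> f1 x \<le> 1"
      and viol: "mean n q (\<lambda>x. f0 x * up n q p (\<lambda>y. 1 - f1 y) x) \<le> \<delta>"
      and f1e: "mean n p f1 \<le> 1 - e"
    have q: "0 < q" "q < p" "p < 1" using pq eps by auto
    have f0: "0 \<le> f0 x" "f0 x \<le> 1" and f1: "0 \<le> f1 x" "f1 x \<le> 1" for x using f0' f1' by auto
    obtain s t h where s: "q + (p - q) / 2 \<le> s" and t: "t \<le> p" and ts: "t - s = (p - q) / (2 * real M)"
      and h: "\<forall>x. h x = 0 \<or> h x = (1::real)"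
      and below: "mean n q (\<lambda>x. f0 x * up n q s (\<lambda>y. 1 - h y) x) \<le> \<eta>0"
      and above: "mean n s h \<le> mean n p f1 + e / 2"
      and sens: "mean n s (\<lambda>x. h x * (1 - noise n s (1 - (t - s) / ((1 - s) * t)) h x)) \<le> 2 / real M"
    proof -
      have "0 \<le> e / 2" using e by simp
      from sharp_threshold_level[OF q M(1) \<eta>0 f0 f1 viol[unfolded \<delta>_def] this] that
      show thesis by (elim exE conjE) simp
    qed
    define \<alpha> where "\<alpha> = (t - s) / ((1 - s) * t)"
    have ts0: "\<epsilon> / (2 * real M) \<le> t - s" "t - s \<le> 1 / (2 * real M)"
      unfolding ts using pq M eps by (auto intro!: divide_right_mono)
    have "0 < \<epsilon> / (2 * real M)" using eps M by simp
    with ts0 have "s < t" by linarith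
    moreover have "\<epsilon> \<le> s" using s pq eps by (simp add: field_simps)
    ultimately have st: "\<epsilon> \<le> s" "s \<le> 1 - \<epsilon>" "\<epsilon> \<le> t" "t \<le> 1 - \<epsilon>" "s < t"
      using t pq by auto
    have den: "\<epsilon>\<^sup>2 \<le> (1 - s) * t" "(1 - s) * t \<le> 1"
      using st eps mult_mono[of \<epsilon> "1 - s" \<epsilon> t] by (auto simp: power2_eq_square intro: mult_le_one)
    have den0: "0 < (1 - s) * t" using st eps by (intro mult_pos_pos) auto
    have al: "0 < \<alpha>" using st den0 by (simp add: \<alpha>_def)
    have "\<epsilon> / (2 * real M) \<le> \<alpha>"
    proof -
      have "t - s \<le> \<alpha>" unfolding \<alpha>_def using den den0 st by (simp add: le_divide_eq_1_pos pos_le_divide_eq mult_left_le)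
      with ts0 show ?thesis by simp
    qed
    then have "C * (\<epsilon> / (2 * real M)) \<le> C * \<alpha>" using C by (intro mult_left_mono) auto
    moreover have "C * (\<epsilon> / (2 * real M)) = 2 / real M" using eps M by (simp add: C_def)
    ultimately have sens': "mean n s (\<lambda>x. h x * (1 - noise n s (1 - \<alpha>) h x)) \<le> C * \<alpha>"
      using sens unfolding \<alpha>_def by linarith
    have "\<alpha> \<le> (1 / (2 * real M)) / \<epsilon>\<^sup>2"
      unfolding \<alpha>_def using ts0 den eps st by (intro frac_le) auto
    also have "\<dots> \<le> \<alpha>0" using M \<alpha>0 eps by (simp add: field_simps)
    finally have al0: "\<alpha> \<le> \<alpha>0" .
    obtain J where J: "J \<subseteq> {..<n}" "card J \<le> l"
      "mean n s (\<lambda>x. (h x - resamp n s (\<lambda>i. i \<notin> J) h x)\<^sup>2) \<le> \<eta>"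
      using junta[rule_format, OF st(1,2) al al0 _ sens'] h by blast
    have s01: "0 \<le> s" "s \<le> 1" and q01: "0 \<le> q" "q \<le> 1" using st q eps by auto
    have "\<exists>b\<in>cube n. resamp n s (\<lambda>i. i \<notin> J) h b \<le> e / 4"
    proof (rule exists_low_restriction[OF s01])
      have "\<eta> < e / 4 * (e / 2)" using e by (simp add: \<eta>_def power2_eq_square)
      also have "\<dots> \<le> e / 4 * (1 - mean n s h)"
        using above f1e e by (intro mult_left_mono) auto
      finally show "mean n s (\<lambda>x. (h x - resamp n s (\<lambda>i. i \<notin> J) h x)\<^sup>2) < e / 4 * (1 - mean n s h)"
        using J by simp
    qed (use h in auto)
    then obtain b where b: "b \<in> cube n" "mean n s (\<lambda>x. h (ovr J b x)) \<le> e / 4"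
      using resamp_eq_mean_ovr[OF s01 J(1)] by auto
    have "q \<le> s" using s q by (simp add: field_simps)
    then have qs: "0 < q" "q \<le> s" "s < 1" using q st eps by auto
    have h1: "0 \<le> h x" "h x \<le> 1" for x using h by (metis order_refl zero_le_one)+
    define F H where "F = (\<lambda>x. f0 (ovr J (\<lambda>_. False) x))" and "H = (\<lambda>x. h (ovr J b x))"
    have F: "0 \<le> F x" "F x \<le> 1" and H: "0 \<le> H x" "H x \<le> 1" for x
      using f0 h1 by (auto simp: F_def H_def)
    have "c ^ card J * mean n q (\<lambda>x. F x * up n q s (\<lambda>y. 1 - H y) x) \<le> mean n q (\<lambda>x. f0 x * up n q s (\<lambda>y. 1 - h y) x)"
      unfolding mean_def up_def F_def H_def
    proof (rule joint_restrict)
      fix i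
      show "c \<le> bern q False * (if False then of_bool (b i) else bern ((s - q) / (1 - q)) (b i))"
      proof -
        have "(1 - q) * ((s - q) / (1 - q)) = s - q" "(1 - q) * (1 - (s - q) / (1 - q)) = 1 - s"
          using qs by (simp_all add: field_simps)
        moreover have "c \<le> s - q" "c \<le> 1 - s" using s pq st eps by (simp_all add: c_def field_simps)
        ultimately show ?thesis by (cases "b i") simp_all
      qed
    qed (use qs f0 h1 c J in \<open>auto intro!: stoch_bern stoch_up\<close>)
    also have "\<dots> \<le> \<eta>0" by (rule below)
    also have "\<dots> \<le> e / 4 * c ^ card J"
      unfolding \<eta>0_def using c e J by (intro mult_left_mono power_decreasing) auto
    finally have "mean n q (\<lambda>x. F x * up n q s (\<lambda>y. 1 - H y) x) \<le> e / 4" using c by simp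
    \<comment> \<open>\<open>F\<close> is at most its violation against \<open>H\<close> plus the
      mean of \<open>H\<close> seen from below; each costs \<open>e / 4\<close>.\<close>
    moreover have "mean n q F \<le> mean n q (\<lambda>x. F x * up n q s (\<lambda>y. 1 - H y) x) + mean n q (up n q s H)"
    proof -
      have eq: "up n q s (\<lambda>y. 1 - H y) x = 1 - up n q s H x" for x
        unfolding up_def kop_diff using kop_const[OF stoch_up[OF qs], of n 1 x] by simp
      have "0 \<le> up n q s H x" for x by (rule up_bounds[OF qs H])
      then have "F x \<le> F x * up n q s (\<lambda>y. 1 - H y) x + up n q s H x" for x
        unfolding eq using mult_left_le_one_le[of "up n q s H x" "F x"] F[of x]
        by (simp add: right_diff_distrib)
      then show ?thesis unfolding mean_simps[symmetric] by (intro mean_mono q01)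
    qed
    moreover have "mean n q (up n q s H) \<le> e / 4" unfolding mean_up[OF qs] using b by (simp add: H_def)
    ultimately have "mean n q (\<lambda>x. f0 (ovr J (\<lambda>_. False) x)) \<le> e / 2" unfolding F_def by simp
    with J show "\<exists>J \<subseteq> {..<n}. card J \<le> l \<and> mean n q (\<lambda>x. f0 (ovr J (\<lambda>_. False) x)) \<le> e / 2" by blast
  qed
qed

section \<open>The energy increment\<close>

lemma finite_set_Pi_pmf: "finite (set_pmf (Pi_pmf {..<n::nat} d (\<lambda>_. P :: 'b::finite pmf)))"
  by (rule finite_subset[OF set_Pi_pmf_subset'[OF finite_lessThan]]) auto

lemma expectation_Pi_pmf_Suc:
  fixes P :: "'b::finite pmf" and F :: "(nat \<Rightarrow> 'b) \<Rightarrow> real"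
  shows "measure_pmf.expectation (Pi_pmf {..<Suc n} d (\<lambda>_. P)) F =
    (\<Sum>v\<in>UNIV. pmf P v * measure_pmf.expectation (Pi_pmf {..<n} d (\<lambda>_. P)) (\<lambda>z. F (z(n := v))))"
proof -
  let ?Q = "Pi_pmf {..<n} d (\<lambda>_. P)"
  have "Pi_pmf {..<Suc n} d (\<lambda>_. P) = P \<bind> (\<lambda>v. map_pmf (\<lambda>z. z(n := v)) ?Q)"
    unfolding lessThan_Suc by (subst Pi_pmf_insert') (auto simp: map_pmf_def)
  then show ?thesis
    using finite_set_Pi_pmf[of n d P] by (simp add: pmf_expectation_bind[of UNIV])
qed

lemma expectation_mu:
  assumes "0 \<le> q" "q \<le> 1"
  shows "measure_pmf.expectation (mu n q) F = mean n q F"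
proof (induction n arbitrary: F)
  case 0
  then show ?case by (simp add: mu_def mean_def)
next
  case (Suc n)
  then show ?case using assms
    by (simp add: mu_def expectation_Pi_pmf_Suc mean_Suc UNIV_bool)
qed

lemma prob_mu:
  assumes "0 \<le> q" "q \<le> 1"
  shows "measure_pmf.prob (mu n q) {x. P x} = mean n q (\<lambda>x. of_bool (P x))"
proof -
  have "measure_pmf.prob (mu n q) {x. P x} = measure_pmf.expectation (mu n q) (indicator {x. P x})"
    by simp
  also have "indicator {x. P x} = (\<lambda>x. of_bool (P x) :: real)" by (auto simp: indicator_def)
  finally show ?thesis by (simp only: expectation_mu[OF assms])
qed

lemma mean_up_Suc:
  "mean (Suc n) q (\<lambda>x. F x * up (Suc n) q p G x) =
     q * mean n q (\<lambda>x. F (x(n := True)) * up n q p (\<lambda>y. G (y(n := True))) x) +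
     (1 - q) * ((p - q) / (1 - q)) * mean n q (\<lambda>x. F (x(n := False)) * up n q p (\<lambda>y. G (y(n := True))) x) +
     (1 - q) * (1 - (p - q) / (1 - q)) * mean n q (\<lambda>x. F (x(n := False)) * up n q p (\<lambda>y. G (y(n := False))) x)"
proof -
  have "mean (Suc n) q (\<lambda>x. F x * up (Suc n) q p G x) =
     q * mean n q (\<lambda>x. F (x(n := True)) * up n q p (\<lambda>y. G (y(n := True))) x) +
     (1 - q) * mean n q (\<lambda>x. F (x(n := False)) * ((p - q) / (1 - q) * up n q p (\<lambda>y. G (y(n := True))) x +
       (1 - (p - q) / (1 - q)) * up n q p (\<lambda>y. G (y(n := False))) x))"
    by (simp add: mean_Suc up_def kop_upd)
  also have "mean n q (\<lambda>x. F (x(n := False)) * ((p - q) / (1 - q) * up n q p (\<lambda>y. G (y(n := True))) x +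
       (1 - (p - q) / (1 - q)) * up n q p (\<lambda>y. G (y(n := False))) x)) =
     (p - q) / (1 - q) * mean n q (\<lambda>x. F (x(n := False)) * up n q p (\<lambda>y. G (y(n := True))) x) +
     (1 - (p - q) / (1 - q)) * mean n q (\<lambda>x. F (x(n := False)) * up n q p (\<lambda>y. G (y(n := False))) x)"
    unfolding mean_simps[symmetric] by (rule arg_cong[of _ _ "mean n q"]) (simp add: fun_eq_iff distrib_left mult.left_commute)
  finally show ?thesis by (simp only: distrib_left mult.assoc add.assoc)
qed

lemma expectation_D:
  assumes "0 < q" "q \<le> p" "p < 1"
  shows "measure_pmf.expectation (D n q p) (\<lambda>(x, y). F x * G y) = mean n q (\<lambda>x. F x * up n q p G x)"
proof -
  have "measure_pmf.expectation (Pi_pmf {..<n} (False, False) (\<lambda>_. coupling q p))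
       (\<lambda>z. F (\<lambda>i. fst (z i)) * G (\<lambda>i. snd (z i))) = mean n q (\<lambda>x. F x * up n q p G x)"
  proof (induction n arbitrary: F G)
    case 0
    then show ?case by (simp add: mean_def up_def)
  next
    case (Suc n)
    have upd: "(\<lambda>i. fst ((z(n := (u, v))) i)) = (\<lambda>i. fst (z i))(n := u)"
       "(\<lambda>i. snd ((z(n := (u, v))) i)) = (\<lambda>i. snd (z i))(n := v)" for z :: "nat \<Rightarrow> bool \<times> bool" and u v
      by auto
    have UN: "(UNIV :: (bool \<times> bool) set) = {(True, True), (True, False), (False, True), (False, False)}"
    proof (rule set_eqI)
      fix w :: "bool \<times> bool"
      show "w \<in> UNIV \<longleftrightarrow> w \<in> {(True, True), (True, False), (False, True), (False, False)}"
        by (cases w; cases "fst w"; cases "snd w") simp_all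
    qed
    have cp: "(1 - q) * ((p - q) / (1 - q)) = p - q" "(1 - q) * (1 - (p - q) / (1 - q)) = 1 - p"
      using assms by (simp_all add: field_simps)
    have pc: "pmf (coupling q p) (True, True) = q" "pmf (coupling q p) (False, True) = p - q"
      "pmf (coupling q p) (False, False) = 1 - p" "pmf (coupling q p) (True, False) = 0"
      using assms by (auto intro!: pmf_coupling)
    show ?case
      unfolding expectation_Pi_pmf_Suc UN mean_up_Suc cp
      using Suc.IH[of "\<lambda>x. F (x(n := True))" "\<lambda>x. G (x(n := True))"]
        Suc.IH[of "\<lambda>x. F (x(n := False))" "\<lambda>x. G (x(n := True))"]
        Suc.IH[of "\<lambda>x. F (x(n := False))" "\<lambda>x. G (x(n := False))"]
      by (simp add: upd pc del: fun_upd_apply)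
  qed
  then show ?thesis by (simp add: D_def case_prod_beta)
qed

lemma prob_D_violation:
  assumes "0 < q" "q \<le> p" "p < 1"
  shows "measure_pmf.prob (D n q p) {(x, y). f x > f y} =
    mean n q (\<lambda>x. of_bool (f x) * up n q p (\<lambda>y. 1 - of_bool (f y)) x)"
proof -
  have "measure_pmf.prob (D n q p) {(x, y). f x > f y} =
    measure_pmf.expectation (D n q p) (indicator {(x, y). f x > f y})" by simp
  also have "indicator {(x, y). f x > f y} = (\<lambda>(x, y). of_bool (f x) * (1 - of_bool (f y)) :: real)"
    by (auto simp: indicator_def fun_eq_iff)
  finally show ?thesis by (simp only: expectation_D[OF assms])
qed

section \<open>Conditioning on a set of coordinates\<close>

lemma mean_cong_cube:
  assumes "0 \<le> r" "r \<le> 1" "\<And>x. x \<in> cube n \<Longrightarrow> f x = g x"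
  shows "mean n r f = mean n r g"
  using assms by (intro antisym mean_mono_cube) auto

lemma ovr_cube: "a \<in> cube n \<Longrightarrow> x \<in> cube n \<Longrightarrow> ovr J a x \<in> cube n"
  by (auto simp: cube_def ovr_def)

text \<open>The weight depends only on the coordinates in \<open>J\<close>, so it is fixed by the
  projection and self-adjointness moves the projection to \<open>f\<close>.\<close>

lemma mean_resamp_cond:
  assumes r: "0 \<le> r" "r \<le> 1" and J: "J \<subseteq> {..<n}"
    and w: "\<And>x z. x \<in> cube n \<Longrightarrow> z \<in> cube n \<Longrightarrow> w (ovr J x z) = w x"
  shows "mean n r (\<lambda>x. f x * w x) = mean n r (\<lambda>x. resamp n r (\<lambda>i. i \<notin> J) f x * w x)"
proof -
  have "mean n r (\<lambda>x. f x * w x) = mean n r (\<lambda>x. f x * resamp n r (\<lambda>i. i \<notin> J) w x)"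
  proof (rule mean_cong_cube[OF r])
    fix x assume x: "x \<in> cube n"
    have "resamp n r (\<lambda>i. i \<notin> J) w x = mean n r (\<lambda>z. w (ovr J x z))"
      by (rule resamp_eq_mean_ovr[OF r J x])
    also have "\<dots> = mean n r (\<lambda>z. w x)" by (rule mean_cong_cube[OF r]) (rule w[OF x])
    finally show "f x * w x = f x * resamp n r (\<lambda>i. i \<notin> J) w x" by (simp add: mean_const[OF r])
  qed
  then show ?thesis by (simp add: mean_resamp_adjoint)
qed

text \<open>The case of \<open>joint_restrict\<close> in which the second point copies the
  first.\<close>

lemma mean_restrict:
  assumes r: "0 \<le> r" "r \<le> 1" and J: "J \<subseteq> {..<n}" and F: "\<And>x. 0 \<le> F x"
    and c: "0 \<le> c" "c \<le> r" "c \<le> 1 - r"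
  shows "c ^ card J * mean n r (\<lambda>x. F (ovr J a x)) \<le> mean n r F"
proof -
  let ?k = "\<lambda>_ a b. of_bool (a = b) :: real"
  have "c ^ card J * kop n (\<lambda>_ _. bern r) (\<lambda>x. F (ovr J a x) * kop n ?k (\<lambda>_. 1) x) (\<lambda>_. False) \<le>
    kop n (\<lambda>_ _. bern r) (\<lambda>x. F x * kop n ?k (\<lambda>_. 1) x) (\<lambda>_. False)"
    by (rule joint_restrict[where b = a])
      (use assms in \<open>auto intro!: stoch_bern stochI simp: bern_def\<close>)
  then show ?thesis by (simp add: kop_id mean_def)
qed

lemma resamp_cong_point:
  "(\<And>i. i \<in> J \<Longrightarrow> x i = y i) \<Longrightarrow> x \<in> cube n \<Longrightarrow> y \<in> cube n \<Longrightarrow>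
   resamp n r (\<lambda>i. i \<notin> J) f x = resamp n r (\<lambda>i. i \<notin> J) f y"
  unfolding resamp_def by (rule kop_cong_point) (auto simp: cube_def)

text \<open>Failure of both desired alternatives at the pattern of \<open>a\<close> on
  \<open>J\<close>. The witness \<open>c\<close> above \<open>a\<close> gives a pair of restrictions
  to which \<open>sharp_threshold_restriction\<close> applies.\<close>

definition bad :: "nat \<Rightarrow> real \<Rightarrow> real \<Rightarrow> real \<Rightarrow> ((nat \<Rightarrow> bool) \<Rightarrow> real) \<Rightarrow> nat set \<Rightarrow> (nat \<Rightarrow> bool) \<Rightarrow> bool" where
  "bad n q p e f J a \<longleftrightarrow> e \<le> resamp n q (\<lambda>i. i \<notin> J) f a \<and>
     (\<exists>c\<in>cube n. (\<forall>i\<in>J. a i \<le> c i) \<and> resamp n p (\<lambda>i. i \<notin> J) f c \<le> 1 - e)"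

text \<open>For a bad pattern some small set \<open>K\<close>, set to zero, lowers the conditional
  mean from at least \<open>e\<close> to at most \<open>e / 2\<close>. Revealing the sets
  \<open>K\<close> of all patterns therefore adds conditional variance on every bad pattern.\<close>

lemma energy_increment:
  fixes f :: "(nat \<Rightarrow> bool) \<Rightarrow> real"
  assumes eps: "0 < \<epsilon>" and e: "0 < e" and pq: "\<epsilon> \<le> q" "p \<le> 1 - \<epsilon>" "\<epsilon> \<le> p - q"
    and f: "\<And>x. 0 \<le> f x" "\<And>x. f x \<le> 1" and J: "J \<subseteq> {..<n}"
    and sharp: "\<forall>f0 f1. (\<forall>x. 0 \<le> f0 x \<and> f0 x \<le> 1) \<longrightarrow> (\<forall>x. 0 \<le> f1 x \<and> f1 x \<le> 1) \<longrightarrow>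
     mean n q (\<lambda>x. f0 x * up n q p (\<lambda>y. 1 - f1 y) x) \<le> \<delta> \<longrightarrow> mean n p f1 \<le> 1 - e \<longrightarrow>
     (\<exists>J \<subseteq> {..<n}. card J \<le> l \<and> mean n q (\<lambda>x. f0 (ovr J (\<lambda>_. False) x)) \<le> e / 2)"
    and viol: "mean n q (\<lambda>x. f x * up n q p (\<lambda>y. 1 - f y) x) \<le> \<delta> * \<epsilon> ^ card J"
    and many: "e \<le> mean n q (\<lambda>x. of_bool (bad n q p e f J x))"
  shows "\<exists>J' \<subseteq> {..<n}. card J' \<le> card J + 2 ^ card J * l \<and>
     mean n q (\<lambda>x. (resamp n q (\<lambda>i. i \<notin> J) f x)\<^sup>2) + e * (\<epsilon> ^ l * (e / 2)\<^sup>2) \<le>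
     mean n q (\<lambda>x. (resamp n q (\<lambda>i. i \<notin> J') f x)\<^sup>2)"
proof -
  have q: "0 < q" "q \<le> p" "p < 1" and q01: "0 \<le> q" "q \<le> 1" and p01: "0 \<le> p" "p \<le> 1" and eps1: "\<epsilon> \<le> 1"
    using eps pq by auto
  have finJ: "finite J" using J finite_subset by blast
  define good where "good x K \<longleftrightarrow> K \<subseteq> {..<n} \<and> card K \<le> l \<and>
    mean n q (\<lambda>z. f (ovr J x (ovr K (\<lambda>_. False) z))) \<le> e / 2" for x K
  have ex_good: "\<exists>K. good x K" if x: "x \<in> cube n" "bad n q p e f J x" for x
  proof -
    obtain c where c: "c \<in> cube n" "\<And>i. i \<in> J \<Longrightarrow> x i \<le> c i" "resamp n p (\<lambda>i. i \<notin> J) f c \<le> 1 - e"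
      using x by (auto simp: bad_def)
    define f0 f1 where "f0 = (\<lambda>z. f (ovr J x z))" and "f1 = (\<lambda>z. f (ovr J c z))"
    \<comment> \<open>The patterns of \<open>x\<close> and \<open>c\<close> are ordered on
      \<open>J\<close>, so each pair of bits has positive coupling probability, at least
      \<open>\<epsilon>\<close>.\<close>
    have "\<epsilon> ^ card J * mean n q (\<lambda>x. f0 x * up n q p (\<lambda>y. 1 - f1 y) x) \<le> mean n q (\<lambda>x. f x * up n q p (\<lambda>y. 1 - f y) x)"
      unfolding mean_def up_def f0_def f1_def
    proof (rule joint_restrict)
      fix i assume "i \<in> J"
      then have "x i \<le> c i" by (rule c(2))
      moreover have "(1 - q) * ((p - q) / (1 - q)) = p - q" "(1 - q) * (1 - (p - q) / (1 - q)) = 1 - p"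
        using q by (simp_all add: field_simps)
      ultimately show "\<epsilon> \<le> bern q (x i) * (if x i then of_bool (c i) else bern ((p - q) / (1 - q)) (c i))"
        using pq by (cases "x i"; cases "c i") auto
    qed (use q f J eps in \<open>auto intro!: stoch_bern stoch_up\<close>)
    with viol have "\<epsilon> ^ card J * mean n q (\<lambda>x. f0 x * up n q p (\<lambda>y. 1 - f1 y) x) \<le> \<epsilon> ^ card J * \<delta>"
      by (simp add: mult.commute)
    then have "mean n q (\<lambda>x. f0 x * up n q p (\<lambda>y. 1 - f1 y) x) \<le> \<delta>" using eps by simp
    moreover have "mean n p f1 \<le> 1 - e"
      using c(3) unfolding f1_def resamp_eq_mean_ovr[OF p01 J c(1)] .
    ultimately obtain K where "K \<subseteq> {..<n}" "card K \<le> l" "mean n q (\<lambda>z. f0 (ovr K (\<lambda>_. False) z)) \<le> e / 2"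
      using sharp[THEN spec[of _ f0], THEN spec[of _ f1]] f by (auto simp: f0_def f1_def)
    then show ?thesis by (auto simp: good_def f0_def)
  qed
  \<comment> \<open>Patterns on \<open>J\<close> are encoded by subsets of \<open>J\<close>, so that
    \<open>Kof\<close> takes at most \<open>2 ^ card J\<close> values and their union stays
    bounded.\<close>
  define pat :: "nat set \<Rightarrow> nat \<Rightarrow> bool" where "pat S = (\<lambda>i. i \<in> S)" for S
  define Kof where "Kof S = (if \<exists>K. good (pat S) K then SOME K. good (pat S) K else {})" for S
  have Kof: "Kof S \<subseteq> {..<n}" "card (Kof S) \<le> l" for S
  proof -
    have "Kof S \<subseteq> {..<n} \<and> card (Kof S) \<le> l"
    proof (cases "\<exists>K. good (pat S) K")
      case True
      then have "good (pat S) (Kof S)" using someI_ex[OF True] by (simp add: Kof_def)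
      then show ?thesis by (simp add: good_def)
    next
      case False
      then show ?thesis by (simp add: Kof_def)
    qed
    then show "Kof S \<subseteq> {..<n}" "card (Kof S) \<le> l" by simp_all
  qed
  have good_Kof: "good x (Kof {i\<in>J. x i})" if x: "x \<in> cube n" "bad n q p e f J x" for x
  proof -
    have eq: "ovr J x = ovr J (pat {i\<in>J. x i})" by (auto simp: ovr_def pat_def fun_eq_iff)
    have "good x = good (pat {i\<in>J. x i})" by (rule ext) (simp only: good_def eq[symmetric])
    with ex_good[OF x] have "\<exists>K. good (pat {i\<in>J. x i}) K" by simp
    then have "good (pat {i\<in>J. x i}) (Kof {i\<in>J. x i})" using someI_ex[of "good (pat {i\<in>J. x i})"] by (simp add: Kof_def)
    with \<open>good x = good (pat {i\<in>J. x i})\<close> show ?thesis by simp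
  qed
  define J' where "J' = J \<union> (\<Union>S\<in>Pow J. Kof S)"
  have J': "J' \<subseteq> {..<n}" "J \<subseteq> J'" using J Kof by (auto simp: J'_def)
  have cardJ': "card J' \<le> card J + 2 ^ card J * l"
  proof -
    have "card (\<Union>S\<in>Pow J. Kof S) \<le> (\<Sum>S\<in>Pow J. card (Kof S))" using finJ by (intro card_UN_le) simp
    also have "\<dots> \<le> (\<Sum>S\<in>Pow J. l)" by (intro sum_mono Kof)
    also have "\<dots> = 2 ^ card J * l" using finJ by (simp add: card_Pow)
    finally show ?thesis unfolding J'_def by (meson add_left_mono card_Un_le order_trans)
  qed
  define P P' where "P = resamp n q (\<lambda>i. i \<notin> J) f" and "P' = resamp n q (\<lambda>i. i \<notin> J') f"
  define v where "v x = (P' x - P x)\<^sup>2" for x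
  have v0: "0 \<le> v x" for x by (simp add: v_def)
  have "resamp n q (\<lambda>i. i \<notin> J) P' = P"
    unfolding P_def P'_def resamp_resamp using J' by (intro resamp_cong) auto
  then have energy: "mean n q v = mean n q (\<lambda>x. (P' x)\<^sup>2) - mean n q (\<lambda>x. (P x)\<^sup>2)"
    unfolding v_def using mean_resamp_diff_square[of n q P' "\<lambda>i. i \<notin> J"] by simp
  have pt: "of_bool (bad n q p e f J x) * (\<epsilon> ^ l * (e / 2)\<^sup>2) \<le> resamp n q (\<lambda>i. i \<notin> J) v x" if x: "x \<in> cube n" for x
  proof (cases "bad n q p e f J x")
    case False
    then show ?thesis unfolding resamp_def using v0 by (auto intro!: kop_nonneg stoch_resamp q01)
  next
    case True
    define K where "K = Kof {i\<in>J. x i}"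
    have K: "K \<subseteq> {..<n}" "card K \<le> l" "mean n q (\<lambda>z. f (ovr J x (ovr K (\<lambda>_. False) z))) \<le> e / 2"
      using good_Kof[OF x True] by (auto simp: good_def K_def)
    have KJ': "J \<union> K \<subseteq> J'" "J \<union> K \<subseteq> {..<n}" using K J by (auto simp: J'_def K_def)
    define b where "b = ovr J x (\<lambda>_. False)"
    have b: "b \<in> cube n" using x by (auto simp: b_def cube_def ovr_def)
    \<comment> \<open>The outer override wins: \<open>K\<close> may meet \<open>J\<close>, and only
      its part outside \<open>J\<close> is set to zero.\<close>
    have ovr2: "ovr J x (ovr K (\<lambda>_. False) z) = ovr (J \<union> K) b z" for z
      by (auto simp: ovr_def b_def fun_eq_iff)
    have "mean n q (\<lambda>z. P' (ovr (J \<union> K) b z)) = resamp n q (\<lambda>i. i \<notin> J \<union> K) P' b"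
      by (rule resamp_eq_mean_ovr[OF q01 KJ'(2) b, symmetric])
    \<comment> \<open>\<open>J \<union> K\<close> lies inside \<open>J'\<close>, so averaging
      \<open>P'\<close> further returns the conditional mean of \<open>f\<close>.\<close>
    also have "resamp n q (\<lambda>i. i \<notin> J \<union> K) P' = resamp n q (\<lambda>i. i \<notin> J \<union> K) f"
      unfolding P'_def resamp_resamp using KJ' by (intro resamp_cong) auto
    also have "resamp n q (\<lambda>i. i \<notin> J \<union> K) f b = mean n q (\<lambda>z. f (ovr (J \<union> K) b z))"
      by (rule resamp_eq_mean_ovr[OF q01 KJ'(2) b])
    also have "\<dots> \<le> e / 2" using K(3) by (simp add: ovr2)
    finally have le: "mean n q (\<lambda>z. P' (ovr (J \<union> K) b z)) \<le> e / 2" .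
    have ge: "e \<le> P x" using True by (simp add: bad_def P_def)
    have Pc: "P (ovr (J \<union> K) b z) = P x" if "z \<in> cube n" for z
      unfolding P_def using x b that
      by (intro resamp_cong_point ovr_cube) (auto simp: ovr_def b_def)
    have "(e / 2)\<^sup>2 \<le> (mean n q (\<lambda>z. P' (ovr (J \<union> K) b z)) - P x)\<^sup>2"
      using le ge e by (subst power2_commute) (intro power_mono, auto)
    also have "mean n q (\<lambda>z. P' (ovr (J \<union> K) b z)) - P x = mean n q (\<lambda>z. P' (ovr (J \<union> K) b z) - P x)"
      by (simp only: mean_simps mean_const[OF q01])
    also have "(\<dots>)\<^sup>2 \<le> mean n q (\<lambda>z. (P' (ovr (J \<union> K) b z) - P x)\<^sup>2)" by (rule mean_square_le[OF q01])
    also have "\<dots> = mean n q (\<lambda>z. v (ovr J x (ovr K (\<lambda>_. False) z)))"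
      by (rule mean_cong_cube[OF q01]) (simp add: v_def ovr2 Pc)
    finally have 1: "(e / 2)\<^sup>2 \<le> mean n q (\<lambda>z. v (ovr J x (ovr K (\<lambda>_. False) z)))" .
    \<comment> \<open>The zero pattern on \<open>K\<close> has probability at least
      \<open>\<epsilon> ^ l\<close>, and the other patterns contribute nonnegatively.\<close>
    have "\<epsilon> ^ l * (e / 2)\<^sup>2 \<le> \<epsilon> ^ card K * mean n q (\<lambda>z. v (ovr J x (ovr K (\<lambda>_. False) z)))"
      using eps eps1 K(2) 1 by (intro mult_mono power_decreasing) auto
    also have "\<dots> \<le> mean n q (\<lambda>z. v (ovr J x z))"
      using mean_restrict[OF q01 K(1), of "\<lambda>z. v (ovr J x z)" \<epsilon> "\<lambda>_. False"] v0 eps pq by simp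
    also have "\<dots> = resamp n q (\<lambda>i. i \<notin> J) v x" by (rule resamp_eq_mean_ovr[OF q01 J x, symmetric])
    finally show ?thesis using True by simp
  qed
  have "e * (\<epsilon> ^ l * (e / 2)\<^sup>2) \<le> mean n q (\<lambda>x. of_bool (bad n q p e f J x)) * (\<epsilon> ^ l * (e / 2)\<^sup>2)"
    using many eps by (intro mult_right_mono) auto
  also have "\<dots> = mean n q (\<lambda>x. of_bool (bad n q p e f J x) * (\<epsilon> ^ l * (e / 2)\<^sup>2))"
    by (rule mean_simps(4)[symmetric])
  also have "\<dots> \<le> mean n q (resamp n q (\<lambda>i. i \<notin> J) v)" by (rule mean_mono_cube[OF q01 pt])
  also have "\<dots> = mean n q v" by (rule mean_resamp)
  finally have "mean n q (\<lambda>x. (P x)\<^sup>2) + e * (\<epsilon> ^ l * (e / 2)\<^sup>2) \<le> mean n q (\<lambda>x. (P' x)\<^sup>2)"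
    unfolding energy by simp
  then show ?thesis using J'(1) cardJ' unfolding P_def P'_def
    by (intro exI[of _ J'] conjI)
qed

text \<open>Take \<open>g\<close> to be the upward closure of the patterns that are not bad and on
  which \<open>f\<close> has \<open>q\<close>-mean at least \<open>e\<close>. Monotonicity is built
  in; the clause of \<open>bad\<close> about all \<open>c\<close> above \<open>a\<close> makes
  \<open>f\<close> nearly 1 at level \<open>p\<close> on the whole closure.\<close>

lemma junta_of_good_restrictions:
  fixes f :: "(nat \<Rightarrow> bool) \<Rightarrow> bool"
  assumes q: "0 \<le> q" "q \<le> 1" and p: "0 \<le> p" "p \<le> 1" and e: "0 < e" and J: "J \<subseteq> {..<n}"
    and few: "mean n q (\<lambda>x. of_bool (bad n q p e (\<lambda>x. of_bool (f x)) J x)) \<le> e"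
  shows "\<exists>g. mono_on (cube n) g \<and> junta n (card J) g \<and>
     mean n q (\<lambda>x. of_bool (f x > g x)) \<le> 2 * e \<and> mean n p (\<lambda>x. of_bool (f x < g x)) \<le> e"
proof -
  define F where "F = (\<lambda>x. of_bool (f x) :: real)"
  have F01: "0 \<le> F x" "F x \<le> 1" for x by (auto simp: F_def)
  define Q where "Q r = resamp n r (\<lambda>i. i \<notin> J) F" for r
  define g where "g x \<longleftrightarrow> (\<exists>a\<in>cube n. (\<forall>i\<in>J. a i \<le> x i) \<and> e \<le> Q q a \<and> \<not> bad n q p e F J a)" for x
  have g_cong: "g x = g y" if "\<forall>i\<in>J. x i = y i" for x y
    unfolding g_def using that by auto
  have g_ovr: "g (ovr J x z) = g x" for x z by (rule g_cong) (simp add: ovr_def)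
  have "mono_on (cube n) g"
  proof (rule mono_onI)
    fix x y :: "nat \<Rightarrow> bool" assume "x \<le> y"
    then have "x i \<le> y i" for i by (simp add: le_fun_def)
    then show "g x \<le> g y" unfolding g_def le_bool_def by (meson order_trans)
  qed
  moreover have "junta n (card J) g" unfolding junta_def using J g_cong by blast
  moreover have "mean n q (\<lambda>x. of_bool (f x > g x)) \<le> 2 * e"
  proof -
    have "mean n q (\<lambda>x. of_bool (f x > g x)) = mean n q (\<lambda>x. F x * of_bool (\<not> g x))"
      by (rule arg_cong[of _ _ "mean n q"]) (auto simp: F_def fun_eq_iff)
    also have "\<dots> = mean n q (\<lambda>x. Q q x * of_bool (\<not> g x))"
      unfolding Q_def by (rule mean_resamp_cond[OF q J]) (simp add: g_ovr)
    also have "\<dots> \<le> mean n q (\<lambda>x. e + of_bool (bad n q p e F J x))"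
    proof (rule mean_mono_cube[OF q])
      fix x assume x: "x \<in> cube n"
      have "Q q x \<le> 1" unfolding Q_def by (rule resamp_bounds[OF q F01])
      \<comment> \<open>Otherwise \<open>x\<close> itself would witness \<open>g x\<close>.\<close>
      moreover have "Q q x < e \<or> bad n q p e F J x" if "\<not> g x"
        using that x unfolding g_def by force
      ultimately show "Q q x * of_bool (\<not> g x) \<le> e + of_bool (bad n q p e F J x)" using e by auto
    qed
    also have "\<dots> = e + mean n q (\<lambda>x. of_bool (bad n q p e F J x))"
      by (simp only: mean_simps mean_const[OF q])
    also have "\<dots> \<le> 2 * e" using few by (simp add: F_def)
    finally show ?thesis .
  qed
  moreover have "mean n p (\<lambda>x. of_bool (f x < g x)) \<le> e"
  proof -
    have "mean n p (\<lambda>x. of_bool (f x < g x)) = mean n p (\<lambda>x. (1 - F x) * of_bool (g x))"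
      by (rule arg_cong[of _ _ "mean n p"]) (auto simp: F_def fun_eq_iff)
    also have "\<dots> = mean n p (\<lambda>x. resamp n p (\<lambda>i. i \<notin> J) (\<lambda>x. 1 - F x) x * of_bool (g x))"
      by (rule mean_resamp_cond[OF p J]) (simp add: g_ovr)
    also have "\<dots> \<le> mean n p (\<lambda>x. e)"
    proof (rule mean_mono_cube[OF p])
      fix x assume x: "x \<in> cube n"
      have eq: "resamp n p (\<lambda>i. i \<notin> J) (\<lambda>x. 1 - F x) x = 1 - Q p x"
        unfolding Q_def resamp_diff using kop_const[OF stoch_resamp[OF p], of n "\<lambda>i. i \<notin> J" 1 x]
        by (simp add: resamp_def)
      \<comment> \<open>Some pattern below \<open>x\<close> is not bad, and \<open>x\<close> is a
        possible \<open>c\<close> for it.\<close>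
      have "1 - e < Q p x" if "g x"
        using that x unfolding g_def bad_def Q_def by force
      then show "resamp n p (\<lambda>i. i \<notin> J) (\<lambda>x. 1 - F x) x * of_bool (g x) \<le> e"
        unfolding eq using e by (cases "g x") auto
    qed
    also have "\<dots> = e" by (rule mean_const[OF p])
    finally show ?thesis .
  qed
  ultimately show ?thesis by (intro exI[of _ g] conjI)
qed

lemma junta_mono:
  assumes "junta n j g" "j \<le> k"
  shows "junta n k g"
proof -
  from assms(1) obtain J where J: "J \<subseteq> {..<n}" "card J \<le> j"
    "\<forall>x \<in> cube n. \<forall>y \<in> cube n. (\<forall>i\<in>J. x i = y i) \<longrightarrow> g x = g y"
    unfolding junta_def by (elim exE conjE) (rule that)
  show ?thesis unfolding junta_def
    by (intro exI[of _ J] conjI J(1,3) order_trans[OF J(2) assms(2)])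
qed

theorem theorem2p5:
  fixes \<epsilon> :: real
  assumes "\<epsilon> > 0"
  shows "\<exists>(j::nat) (\<delta>::real). \<delta> > 0 \<and>
    (\<forall>(n::nat) (p::real) (q::real) (f :: (nat \<Rightarrow> bool) \<Rightarrow> bool).
       p \<in> {\<epsilon><..<1 - \<epsilon>} \<longrightarrow> q \<in> {\<epsilon><..<1 - \<epsilon>} \<longrightarrow> p - q > \<epsilon> \<longrightarrow>
       almost_monotone n q p \<delta> f \<longrightarrow>
       (\<exists>g :: (nat \<Rightarrow> bool) \<Rightarrow> bool.
          mono_on (cube n) g \<and> junta n j g \<and>
          measure_pmf.prob (mu n q) {x. f x > g x} < \<epsilon> \<and>
          measure_pmf.prob (mu n p) {x. f x < g x} < \<epsilon>))"
proof (cases "\<epsilon> \<le> 1/2")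
  case False
  \<comment> \<open>The interval for \<open>p\<close> is empty here.\<close>
  then show ?thesis by (intro exI[of _ 0] exI[of _ 1]) auto
next
  case True
  note eps = assms True
  \<comment> \<open>The errors of the junta are at most \<open>2 * e\<close> and \<open>e\<close>,
    both strictly below \<open>\<epsilon>\<close>.\<close>
  define e where "e = \<epsilon> / 3"
  have e: "0 < e" using eps by (simp add: e_def)
  from sharp_threshold_restriction[OF eps e]
  obtain l \<delta> where \<delta>: "0 < \<delta>" and sharp: "\<forall>n p q f0 f1. \<epsilon> \<le> q \<longrightarrow> p \<le> 1 - \<epsilon> \<longrightarrow> \<epsilon> \<le> p - q \<longrightarrow>
     (\<forall>x. 0 \<le> f0 x \<and> f0 x \<le> 1) \<longrightarrow> (\<forall>x. 0 \<le> f1 x \<and> f1 x \<le> 1) \<longrightarrow>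
     mean n q (\<lambda>x. f0 x * up n q p (\<lambda>y. 1 - f1 y) x) \<le> \<delta> \<longrightarrow> mean n p f1 \<le> 1 - e \<longrightarrow>
     (\<exists>J \<subseteq> {..<n}. card J \<le> l \<and> mean n q (\<lambda>x. f0 (ovr J (\<lambda>_. False) x)) \<le> e / 2)"
    by (elim exE conjE) (rule that)
  \<comment> \<open>An upper bound for the number of revealed coordinates after \<open>k\<close>
    energy increments.\<close>
  define N where "N k = ((\<lambda>v. v + 2 ^ v * l) ^^ k) 0" for k
  have N_Suc: "N (Suc k) = N k + 2 ^ N k * l" for k by (simp add: N_def)
  have N_mono: "N k \<le> N k'" if "k \<le> k'" for k k'
    using that by (rule lift_Suc_mono_le[of N, rotated]) (simp add: N_Suc)
  define inc where "inc = e * (\<epsilon> ^ l * (e / 2)\<^sup>2)"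
  have inc: "0 < inc" using e eps by (simp add: inc_def)
  \<comment> \<open>The energy never exceeds 1, so fewer than \<open>R\<close> increments are
    possible.\<close>
  obtain R :: nat where R: "1 < real R * inc" using ex_less_of_nat_mult[OF inc] by blast
  \<comment> \<open>The factor \<open>\<epsilon> ^ N R\<close> keeps the violation probability below
    \<open>\<delta>\<close> after restricting up to \<open>N R\<close> coordinates.\<close>
  have "\<exists>g. mono_on (cube n) g \<and> junta n (N R) g \<and>
          measure_pmf.prob (mu n q) {x. f x > g x} < \<epsilon> \<and>
          measure_pmf.prob (mu n p) {x. f x < g x} < \<epsilon>"
    if p: "p \<in> {\<epsilon><..<1 - \<epsilon>}" and q: "q \<in> {\<epsilon><..<1 - \<epsilon>}" and pq: "p - q > \<epsilon>"
      and am: "almost_monotone n q p (\<delta> * \<epsilon> ^ N R) f" for n p q and f :: "(nat \<Rightarrow> bool) \<Rightarrow> bool"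
  proof -
    define F where "F = (\<lambda>x. of_bool (f x) :: real)"
    have F01: "0 \<le> F x" "F x \<le> 1" for x by (auto simp: F_def)
    have q01: "0 \<le> q" "q \<le> 1" and p01: "0 \<le> p" "p \<le> 1" using p q eps by auto
    have pq': "\<epsilon> \<le> q" "p \<le> 1 - \<epsilon>" "\<epsilon> \<le> p - q" using p q pq by auto
    have viol: "mean n q (\<lambda>x. F x * up n q p (\<lambda>y. 1 - F y) x) \<le> \<delta> * \<epsilon> ^ N R"
      using am prob_D_violation[of q p n f] p q pq eps by (simp add: almost_monotone_def F_def)
    have sharp': "\<forall>f0 f1. (\<forall>x. 0 \<le> f0 x \<and> f0 x \<le> 1) \<longrightarrow> (\<forall>x. 0 \<le> f1 x \<and> f1 x \<le> 1) \<longrightarrow>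
     mean n q (\<lambda>x. f0 x * up n q p (\<lambda>y. 1 - f1 y) x) \<le> \<delta> \<longrightarrow> mean n p f1 \<le> 1 - e \<longrightarrow>
     (\<exists>J \<subseteq> {..<n}. card J \<le> l \<and> mean n q (\<lambda>x. f0 (ovr J (\<lambda>_. False) x)) \<le> e / 2)"
    proof (intro allI)
      fix f0 f1
      show "(\<forall>x. 0 \<le> f0 x \<and> f0 x \<le> 1) \<longrightarrow> (\<forall>x. 0 \<le> f1 x \<and> f1 x \<le> 1) \<longrightarrow>
        mean n q (\<lambda>x. f0 x * up n q p (\<lambda>y. 1 - f1 y) x) \<le> \<delta> \<longrightarrow> mean n p f1 \<le> 1 - e \<longrightarrow>
        (\<exists>J \<subseteq> {..<n}. card J \<le> l \<and> mean n q (\<lambda>x. f0 (ovr J (\<lambda>_. False) x)) \<le> e / 2)"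
        using sharp[THEN spec[of _ n], THEN spec[of _ p], THEN spec[of _ q], THEN spec[of _ f0], THEN spec[of _ f1]] pq'
        by (simp only: simp_thms)
    qed
    define \<Phi> where "\<Phi> J = mean n q (\<lambda>x. (resamp n q (\<lambda>i. i \<notin> J) F x)\<^sup>2)" for J
    have \<Phi>1: "\<Phi> J \<le> 1" for J
    proof -
      have "(resamp n q (\<lambda>i. i \<notin> J) F x)\<^sup>2 \<le> 1" for x
        using resamp_bounds[OF q01 F01] by (intro power_le_one) auto
      then show ?thesis unfolding \<Phi>_def by (rule mean_le_const[OF q01])
    qed
    define few where "few J \<longleftrightarrow> mean n q (\<lambda>x. of_bool (bad n q p e F J x)) \<le> e" for J
    \<comment> \<open>Either some set within the size bound has few bad patterns, or the energy has
      grown by \<open>inc\<close> in each of \<open>k\<close> rounds.\<close>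
    have "(\<exists>J \<subseteq> {..<n}. card J \<le> N R \<and> few J) \<or> (\<exists>J \<subseteq> {..<n}. card J \<le> N k \<and> real k * inc \<le> \<Phi> J)"
      if "k \<le> R" for k
      using that
    proof (induction k)
      case 0
      have "0 \<le> \<Phi> {}" unfolding \<Phi>_def by (rule mean_nonneg[OF q01]) simp
      then show ?case by (intro disjI2 exI[of _ "{}"]) simp
    next
      case (Suc k)
      show ?case
      proof (cases "\<exists>J \<subseteq> {..<n}. card J \<le> N R \<and> few J")
        case False
        have "k \<le> R" using Suc.prems by simp
        from Suc.IH[OF this] False have "\<exists>J \<subseteq> {..<n}. card J \<le> N k \<and> real k * inc \<le> \<Phi> J"
          by (simp only: simp_thms)
        then obtain J where J: "J \<subseteq> {..<n}" "card J \<le> N k" "real k * inc \<le> \<Phi> J"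
          by (elim exE conjE) (rule that)
        have NR: "card J \<le> N R" using J(2) N_mono[of k R] Suc.prems by simp
        have many: "e \<le> mean n q (\<lambda>x. of_bool (bad n q p e F J x))"
        proof (rule ccontr)
          assume "\<not> e \<le> mean n q (\<lambda>x. of_bool (bad n q p e F J x))"
          then have "few J" by (simp add: few_def)
          with False J(1) NR show False by blast
        qed
        have "\<delta> * \<epsilon> ^ N R \<le> \<delta> * \<epsilon> ^ card J"
          using \<delta> eps NR by (intro mult_left_mono power_decreasing) auto
        with viol have "mean n q (\<lambda>x. F x * up n q p (\<lambda>y. 1 - F y) x) \<le> \<delta> * \<epsilon> ^ card J" by simp
        from energy_increment[OF eps(1) e pq' F01 J(1) sharp' this many, folded \<Phi>_def inc_def]
        obtain J' where J': "J' \<subseteq> {..<n}" "card J' \<le> card J + 2 ^ card J * l" "\<Phi> J + inc \<le> \<Phi> J'"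
          by (elim exE conjE) (rule that)
        have "card J + 2 ^ card J * l \<le> N (Suc k)"
          unfolding N_Suc using J(2) by (intro add_mono mult_right_mono power_increasing) auto
        moreover have "real (Suc k) * inc \<le> \<Phi> J'" using J(3) J'(3) by (simp add: algebra_simps)
        ultimately show ?thesis using J' by (intro disjI2 exI[of _ J']) auto
      qed simp
    qed
    from this[OF order_refl] have "\<exists>J \<subseteq> {..<n}. card J \<le> N R \<and> few J"
    proof (rule disjE)
      assume "\<exists>J \<subseteq> {..<n}. card J \<le> N R \<and> real R * inc \<le> \<Phi> J"
      then obtain J where "real R * inc \<le> \<Phi> J" by (elim exE conjE) (rule that)
      with R have "1 < \<Phi> J" by (rule less_le_trans)
      with \<Phi>1[of J] show ?thesis by simp
    qed
    then obtain J where J: "J \<subseteq> {..<n}" "card J \<le> N R" "few J" by (elim exE conjE) (rule that)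
    from junta_of_good_restrictions[OF q01 p01 e J(1) J(3)[unfolded few_def F_def]]
    obtain g where g: "mono_on (cube n) g" "junta n (card J) g"
      "mean n q (\<lambda>x. of_bool (f x > g x)) \<le> 2 * e" "mean n p (\<lambda>x. of_bool (f x < g x)) \<le> e"
      by (elim exE conjE) (rule that)
    have "junta n (N R) g" by (rule junta_mono[OF g(2) J(2)])
    moreover have "measure_pmf.prob (mu n q) {x. f x > g x} < \<epsilon>"
      using g(3) e by (simp only: prob_mu[OF q01]) (simp add: e_def)
    moreover have "measure_pmf.prob (mu n p) {x. f x < g x} < \<epsilon>"
      using g(4) e by (simp only: prob_mu[OF p01]) (simp add: e_def)
    ultimately show ?thesis using g(1) by (intro exI[of _ g] conjI)
  qed
  moreover have "0 < \<delta> * \<epsilon> ^ N R" using \<delta> eps by simp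
  ultimately show ?thesis
    by (intro exI[of _ "N R"] exI[of _ "\<delta> * \<epsilon> ^ N R"] conjI allI impI)
qed

end
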